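(* Assume the rank-1 model described in the context, that the community size $r$ is known, and that Assumption 3 holds. Fix $\epsilon>0$ and consider the scan test that rejects (outputs $1$) if and only if \[ T^{\mathsf u}:=\max_{D\subseteq V,\ r^{1/3}\le|D|\le r}T^{\mathsf u}_D\ \ge\ 1+\frac{\epsilon}{3}. \] This test is asymptotically powerful provided the following three conditions hold: $r=o(n)$; $\mathbb{E}_C[e(D^\star_C)]\to\infty$ for all $C\subseteq V$ with $|C|=r$; and for every $C\subseteq V$ with $|C|=r$, \[ \max_{\emptyset\ne D\subseteq C}\frac{\mathbb{E}_0[e(D)]\,h(\rho_C-1)}{|D|\log(n/|D|)}\ge1+\epsilon . \]
   Context: Rank-1 setting. For each $n$ let $V=\{1,\dots,n\}$ and let vertex weights $\theta_i\in(0,1)$ be given, with edge probabilities $p_{ij}=\theta_i\theta_j$ ($i\ne j$). Let $r=r_n$ be a community size, and for every $C\subseteq V$ with $|C|=r$ let $\rho_C>1$ with $\rho_Cp_{ij}\le1$ for $i,j\in C$. All may depend on $n$, and limits are as $n\to\infty$. Observe a simple undirected graph with adjacency matrix $A$. Under $\mathbb{P}_0$ the $A_{ij}$ ($i<j$) are independent $\mathrm{Bern}(p_{ij})$. Under $\mathbb{P}_C$ they are independent with $A_{ij}\sim\mathrm{Bern}(\rho_Cp_{ij})$ for $i,j\in C$ and $\mathrm{Bern}(p_{ij})$ otherwise. $\mathbb{E}_0,\mathbb{E}_C$ are the corresponding expectations. The edge probabilities (weights) are unknown to the test. The worst-case risk of a test $\psi_n$ is $R_n(\psi_n)=\mathbb{P}_0(\psi_n\ne0)+\max_{|C|=r}\mathbb{P}_C(\psi_n\ne1)$,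 and the test is asymptotically powerful if $R_n\to0$. Assumption 3. With $\theta_{\max}=\max_i\theta_i$ and $\theta_{\min}=\min_i\theta_i$: $(\theta_{\max}/\theta_{\min})^2=o\big(r^{2/3}\wedge\tfrac nr\theta_{\min}^2\big)$. Notation. $e(D)=\sum_{i<j,\ i,j\in D}A_{ij}$ and $e(D,-D)=\sum_{i\in D,j\notin D}A_{ij}$. $h(x)=(x+1)\log(x+1)-x$. $[x]_+=\max\{x,0\}$. $\widehat{E}_D=\tfrac14\big(\sqrt{e(V)}-\sqrt{e(V)-2e(D,-D)}\big)^2$ and $\widetilde E_D=\max\{\widehat E_D,\ \tfrac{|D|^2}{n}\log^4(n/|D|)\}$. $T^{\mathsf u}_D=\widetilde E_D\,h\big([e(D)/\widetilde E_D-1]_+\big)/(|D|\log(n/|D|))$. For $|C|=r$, $D^\star_C$ is a maximizer of $\frac{\mathbb{E}_0[e(D)]}{|D|\log(n/|D|)}$ over nonempty $D\subseteq C$. *)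

theory Defs
  imports "HOL-Analysis.Analysis" "HOL-Library.Landau_Symbols"
begin

text \<open>Vertices are 1..n. A graph is a set of pairs (i,j) with 1 <= i < j <= n.\<close>

definition pairs :: "nat \<Rightarrow> (nat \<times> nat) set" where
  "pairs n = {(i,j). 1 \<le> i \<and> i < j \<and> j \<le> n}"

definition graph_prob :: "nat \<Rightarrow> (nat \<Rightarrow> nat \<Rightarrow> real) \<Rightarrow> (nat \<times> nat) set \<Rightarrow> real" where
  "graph_prob n q G = (\<Prod>(i,j)\<in>pairs n. if (i,j) \<in> G then q i j else 1 - q i j)"

definition prob_ev :: "nat \<Rightarrow> (nat \<Rightarrow> nat \<Rightarrow> real) \<Rightarrow> ((nat \<times> nat) set \<Rightarrow> bool) \<Rightarrow> real" where
  "prob_ev n q S = (\<Sum>G\<in>{G. G \<subseteq> pairs n \<and> S G}. graph_prob n q G)"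

definition expect :: "nat \<Rightarrow> (nat \<Rightarrow> nat \<Rightarrow> real) \<Rightarrow> ((nat \<times> nat) set \<Rightarrow> real) \<Rightarrow> real" where
  "expect n q f = (\<Sum>G\<in>Pow (pairs n). graph_prob n q G * f G)"

definition p_null :: "(nat \<Rightarrow> real) \<Rightarrow> nat \<Rightarrow> nat \<Rightarrow> real" where
  "p_null th i j = th i * th j"

definition p_planted :: "(nat \<Rightarrow> real) \<Rightarrow> real \<Rightarrow> nat set \<Rightarrow> nat \<Rightarrow> nat \<Rightarrow> real" where
  "p_planted th rho C i j = (if i \<in> C \<and> j \<in> C then rho * th i * th j else th i * th j)"

definition e_in :: "(nat \<times> nat) set \<Rightarrow> nat set \<Rightarrow> real" where
  "e_in G D = real (card {(i,j)\<in>G. i \<in> D \<and> j \<in> D})"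

definition e_cut :: "(nat \<times> nat) set \<Rightarrow> nat set \<Rightarrow> real" where
  "e_cut G D = real (card {(i,j)\<in>G. (i \<in> D) \<noteq> (j \<in> D)})"

definition e_all :: "(nat \<times> nat) set \<Rightarrow> real" where
  "e_all G = real (card G)"

definition hfun :: "real \<Rightarrow> real" where
  "hfun x = (x + 1) * ln (x + 1) - x"

definition E_hat :: "(nat \<times> nat) set \<Rightarrow> nat set \<Rightarrow> real" where
  "E_hat G D = (1/4) * (sqrt (e_all G) - sqrt (e_all G - 2 * e_cut G D))^2"

definition E_tilde :: "nat \<Rightarrow> (nat \<times> nat) set \<Rightarrow> nat set \<Rightarrow> real" where
  "E_tilde n G D = max (E_hat G D) ((real (card D))^2 / real n * (ln (real n / real (card D)))^4)"

definition T_u :: "nat \<Rightarrow> (nat \<times> nat) set \<Rightarrow> nat set \<Rightarrow> real" where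
  "T_u n G D = E_tilde n G D * hfun (max (e_in G D / E_tilde n G D - 1) 0)
               / (real (card D) * ln (real n / real (card D)))"

definition T_stat :: "nat \<Rightarrow> nat \<Rightarrow> (nat \<times> nat) set \<Rightarrow> real" where
  "T_stat n r G = Max {T_u n G D | D. D \<subseteq> {1..n} \<and> real r powr (1/3) \<le> real (card D) \<and> card D \<le> r}"

definition scan_test :: "nat \<Rightarrow> nat \<Rightarrow> real \<Rightarrow> (nat \<times> nat) set \<Rightarrow> bool" where
  "scan_test n r eps G = (T_stat n r G \<ge> 1 + eps / 3)"

definition risk :: "nat \<Rightarrow> (nat \<Rightarrow> real) \<Rightarrow> nat \<Rightarrow> (nat set \<Rightarrow> real) \<Rightarrow> ((nat \<times> nat) set \<Rightarrow> bool) \<Rightarrow> real" where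
  "risk n th r rho psi =
     prob_ev n (p_null th) psi +
     Max {prob_ev n (p_planted th (rho C) C) (\<lambda>G. \<not> psi G) | C. C \<subseteq> {1..n} \<and> card C = r}"

end

theory Submission
  imports Defs
begin

text \<open>
  Write \<open>t\<close> and \<open>S\<close> for the total weights of \<open>D\<close> and \<open>V\<close>, and \<open>phi x E = E h([x/E - 1]_+)\<close>, the Chernoff
  exponent of the upper tail of an edge count. If \<open>e(V)\<close> and \<open>e(D,-D)\<close> are replaced by
  \<open>S\<^sup>2/2\<close> and \<open>t (S - t)\<close>, the estimator \<open>E_hat\<close> becomes \<open>t\<^sup>2/2\<close>, which is at least the null mean
  of \<open>e(D)\<close>. The scan statistic tolerates a relative error in \<open>E_hat\<close> that is small compared to
  \<open>min 1 (sqrt (|D| log (n/|D|)) / t)\<close>.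

  Under the null hypothesis a union bound over all \<open>D\<close> achieves this precision for the cut size of
  every \<open>D\<close> with \<open>t\<^sup>2/2\<close> above the floor built into \<open>E_tilde\<close>; for the other \<open>D\<close> no estimate is
  needed. Under the alternative only the maximizer inside \<open>C\<close> has to be examined. Comparison with
  \<open>C\<close> shows that it has at least \<open>r powr (1/3)\<close> vertices, so the diagonal terms missing from its null mean
  are negligible, and the signal condition bounds \<open>rho - 1\<close> from below by the precision above. If the
  floor exceeds the null mean of the maximizer, then \<open>rho\<close> is at least a power of \<open>n/|D|\<close>, and the
  resulting loss, of order \<open>log log (n/|D|)\<close> against \<open>log rho\<close>, is harmless.
\<close>

section \<open>The Chernoff exponent\<close>

lemma hfun_has_derivative:
  assumes "u > -1"
  shows "(hfun has_real_derivative ln (1 + u)) (at u)"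
proof -
  have "((\<lambda>x. (x + 1) * ln (x + 1) - x) has_real_derivative ln (1 + u)) (at u)"
    using assms by (auto intro!: derivative_eq_intros simp: field_simps)
  then show ?thesis by (simp add: hfun_def [abs_def])
qed

lemma hfun_0 [simp]: "hfun 0 = 0"
  by (simp add: hfun_def)

lemma hfun_mono:
  assumes "0 \<le> u" "u \<le> v"
  shows "hfun u \<le> hfun v"
  using assms
  by (intro DERIV_nonneg_imp_nondecreasing [of u v hfun])
    (auto intro!: exI hfun_has_derivative ln_ge_zero)

lemma hfun_nonneg: "0 \<le> u \<Longrightarrow> 0 \<le> hfun u"
  using hfun_mono[of 0 u] by simp

text \<open>The derivative \<open>ln (1 + x)\<close> of \<open>hfun\<close> is at most
  \<open>x\<close>. This is what turns a lower bound on an exponent into a lower bound on a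
  deviation.\<close>

lemma hfun_le_square:
  assumes "0 \<le> u"
  shows "hfun u \<le> u\<^sup>2 / 2"
proof -
  have "(\<lambda>x. x\<^sup>2 / 2 - hfun x) 0 \<le> (\<lambda>x. x\<^sup>2 / 2 - hfun x) u"
  proof (rule DERIV_nonneg_imp_nondecreasing [OF assms])
    fix x :: real assume "0 \<le> x" "x \<le> u"
    then show "\<exists>y. ((\<lambda>x. x\<^sup>2 / 2 - hfun x) has_real_derivative y) (at x) \<and> 0 \<le> y"
      by (intro exI[of _ "x - ln (1 + x)"])
        (auto intro!: derivative_eq_intros hfun_has_derivative ln_add_one_self_le_self)
  qed
  then show ?thesis by simp
qed

text \<open>Both sides vanish at \<open>u = 0\<close>, and the derivative
  \<open>l / (1 + l * x)\<close> dominates \<open>l / (1 + x)\<close> because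
  \<open>l <= 1\<close>.\<close>

lemma ln_one_plus_scale:
  assumes "0 \<le> l" "l \<le> 1" "0 \<le> (u::real)"
  shows "l * ln (1 + u) \<le> ln (1 + l * u)"
proof -
  have "(\<lambda>x. ln (1 + l * x) - l * ln (1 + x)) 0 \<le> (\<lambda>x. ln (1 + l * x) - l * ln (1 + x)) u"
  proof (rule DERIV_nonneg_imp_nondecreasing [OF assms(3)])
    fix x :: real assume x: "0 \<le> x" "x \<le> u"
    have pos: "0 < 1 + l * x" "0 < 1 + x"
      using x assms by (auto intro: add_pos_nonneg)
    have "l * x \<le> x" using x assms by (simp add: mult_left_le_one_le)
    then have "0 \<le> l / (1 + l * x) - l / (1 + x)"
      using pos assms by (simp add: frac_le)
    then show "\<exists>y. ((\<lambda>x. ln (1 + l * x) - l * ln (1 + x)) has_real_derivative y) (at x) \<and> 0 \<le> y"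
      using pos by (intro exI[of _ "l / (1 + l * x) - l / (1 + x)"])
        (auto intro!: derivative_eq_intros)
  qed
  then show ?thesis by simp
qed

text \<open>Differentiating in \<open>u\<close> reduces this to the preceding inequality for
  logarithms. Shrinking a relative excess by \<open>l\<close> thus costs at most a factor
  \<open>l^2\<close> of the exponent, for small and large excesses alike.\<close>

lemma hfun_scale:
  assumes "0 \<le> l" "l \<le> 1" "0 \<le> u"
  shows "l\<^sup>2 * hfun u \<le> hfun (l * u)"
proof -
  have "(\<lambda>x. hfun (l * x) - l\<^sup>2 * hfun x) 0 \<le> (\<lambda>x. hfun (l * x) - l\<^sup>2 * hfun x) u"
  proof (rule DERIV_nonneg_imp_nondecreasing [OF assms(3)])
    fix x :: real assume x: "0 \<le> x" "x \<le> u"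
    have pos: "-1 < l * x" using x assms by (meson less_le_trans mult_nonneg_nonneg neg_less_0_iff_less zero_less_one)
    have "l * (l * ln (1 + x)) \<le> l * ln (1 + l * x)"
      using ln_one_plus_scale[OF assms(1,2)] x assms by (intro mult_left_mono) auto
    moreover have "((\<lambda>x. hfun (l * x)) has_real_derivative ln (1 + l * x) * l) (at x)"
      using DERIV_chain2[of hfun "ln (1 + l * x)" "\<lambda>x. l * x" x l UNIV] hfun_has_derivative[OF pos]
      by (auto intro!: derivative_eq_intros)
    then have "((\<lambda>x. hfun (l * x) - l\<^sup>2 * hfun x) has_real_derivative
        (ln (1 + l * x) * l - l\<^sup>2 * ln (1 + x))) (at x)"
      using x by (auto intro!: derivative_eq_intros hfun_has_derivative)
    ultimately show "\<exists>y. ((\<lambda>x. hfun (l * x) - l\<^sup>2 * hfun x) has_real_derivative y) (at x) \<and> 0 \<le> y"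
      by (intro exI[of _ "ln (1 + l * x) * l - l\<^sup>2 * ln (1 + x)"])
        (auto simp: power2_eq_square algebra_simps)
  qed
  then show ?thesis by simp
qed

definition phi :: "real \<Rightarrow> real \<Rightarrow> real" where
  "phi x E = E * hfun (max (x / E - 1) 0)"

lemma phi_below: "0 < E \<Longrightarrow> x \<le> E \<Longrightarrow> phi x E = 0"
  by (simp add: phi_def max_def field_simps)

lemma phi_above:
  assumes "0 < E" "E \<le> x"
  shows "phi x E = x * ln (x / E) - x + E"
proof -
  have "max (x / E - 1) 0 = x / E - 1" using assms by (simp add: field_simps)
  then show ?thesis using assms by (simp add: phi_def hfun_def field_simps)
qed

lemma phi_nonneg: "0 < E \<Longrightarrow> 0 \<le> phi x E"
  by (simp add: phi_def hfun_nonneg)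

lemma phi_mono:
  assumes "0 < E" "x \<le> y"
  shows "phi x E \<le> phi y E"
proof -
  have "x / E \<le> y / E" using assms by (simp add: divide_right_mono)
  then show ?thesis
    unfolding phi_def using assms by (intro mult_left_mono hfun_mono) auto
qed

text \<open>For \<open>x > E'\<close> the difference of the exponents is
  \<open>x * ln (E' / E) + E - E'\<close>, and \<open>ln z <= z - 1\<close> at
  \<open>z = E / E'\<close> bounds it below by \<open>(E' - E) * (x / E' - 1)\<close>. An error in
  the null mean can therefore be replaced by a one-sided bound on it.\<close>

lemma phi_antimono:
  assumes "0 < E" "E \<le> E'"
  shows "phi x E' \<le> phi x E"
proof (cases "x \<le> E'")
  case True
  then show ?thesis using assms phi_below[of E' x] phi_nonneg[of E x] by simp
next
  case False
  have "ln (E / E') \<le> E / E' - 1" using assms by (intro ln_le_minus_one) auto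
  then have "1 - E / E' \<le> ln (E' / E)" using assms by (simp add: ln_div)
  then have "x * (1 - E / E') \<le> x * ln (E' / E)" using False assms by (intro mult_left_mono) auto
  moreover have "x * (1 - E / E') + E - E' = (E' - E) * (x / E' - 1)"
    using assms by (simp add: field_simps)
  moreover have "0 \<le> (E' - E) * (x / E' - 1)"
    using False assms by (intro mult_nonneg_nonneg) (auto simp: field_simps)
  moreover have "x * ln (x / E) - x * ln (x / E') = x * ln (E' / E)"
    using False assms by (simp add: ln_div algebra_simps)
  moreover have "phi x E' = x * ln (x / E') - x + E'" "phi x E = x * ln (x / E) - x + E"
    using False assms by (auto intro!: phi_above)
  ultimately show ?thesis by linarith
qed

text \<open>The relative excess of \<open>x'\<close> over \<open>E'\<close> is at least
  \<open>l * u\<close> with \<open>l = (1 - c) * (E / E')\<close>. \<open>hfun_scale\<close> costs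
  \<open>l^2\<close>; the prefactor \<open>E'\<close> cancels one of the two ratios
  \<open>E / E'\<close>, and the other is at least \<open>1 - c\<close>. This gives three factors
  \<open>1 - c\<close> in all.\<close>

lemma phi_perturb:
  assumes E: "0 < E" "E \<le> E'" "E' \<le> (1 + c) * E" and c: "0 \<le> c" "c \<le> 1"
    and x: "E \<le> x" "(1 - c) * (x - E) \<le> x' - E'"
  shows "(1 - c)^3 * phi x E \<le> phi x' E'"
proof -
  define l where "l = (1 - c) * (E / E')"
  define u where "u = (x - E) / E"
  have E': "0 < E'" using E by simp
  have u: "0 \<le> u" using E x by (simp add: u_def)
  have ratio: "E / E' \<le> 1" "0 \<le> E / E'" using E E' by auto
  have l: "0 \<le> l" "l \<le> 1"
    unfolding l_def using ratio c by (auto intro: mult_nonneg_nonneg mult_le_one simp del: times_divide_eq_right)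
  have "(1 - c) * E' \<le> (1 - c) * ((1 + c) * E)" using E c by (intro mult_left_mono) auto
  also have "\<dots> = E - c\<^sup>2 * E" by (simp add: power2_eq_square algebra_simps)
  also have "\<dots> \<le> E" using E by simp
  finally have ratio2: "1 - c \<le> E / E'" using E' by (simp add: field_simps)
  have phi_x: "phi x E = E * hfun u"
  proof -
    have "x / E - 1 = u" using E by (simp add: u_def field_simps)
    then show ?thesis using u by (simp add: phi_def)
  qed
  have "l * u = (1 - c) * (x - E) / E'" using E E' by (simp add: l_def u_def)
  also have "\<dots> \<le> (x' - E') / E'" using x E' by (intro divide_right_mono) auto
  also have "\<dots> = x' / E' - 1" using E' by (simp add: field_simps)
  finally have lu: "l * u \<le> max (x' / E' - 1) 0" by simp
  have "(1 - c)^3 * phi x E = (1 - c)\<^sup>2 * (1 - c) * (E * hfun u)"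
    by (simp add: phi_x power3_eq_cube power2_eq_square)
  also have "\<dots> \<le> (1 - c)\<^sup>2 * (E / E') * (E * hfun u)"
    using ratio2 E u hfun_nonneg by (intro mult_right_mono mult_left_mono) auto
  also have "\<dots> = E' * (l\<^sup>2 * hfun u)"
    using E' by (simp add: l_def power2_eq_square)
  also have "\<dots> \<le> E' * hfun (l * u)"
    using hfun_scale[OF l u] E' by (intro mult_left_mono) auto
  also have "\<dots> \<le> phi x' E'"
    unfolding phi_def using E' l u lu by (intro mult_left_mono hfun_mono) auto
  finally show ?thesis .
qed

text \<open>By the quadratic bound on \<open>hfun\<close>, an exponent of \<open>y\<close> requires
  a deviation of at least the Gaussian size \<open>sqrt (2 * y * E)\<close>. Errors in
  \<open>E\<close> that are small on this scale are harmless.\<close>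

lemma phi_gap:
  assumes "0 < E" "0 < y" "y \<le> phi x E"
  shows "E < x" "2 * y * E \<le> (x - E)\<^sup>2"
proof -
  show "E < x" using phi_below[of E x] assms by fastforce
  then have u: "0 \<le> x / E - 1" using assms by (simp add: field_simps)
  have "y \<le> E * hfun (x / E - 1)" using assms(3) u by (simp add: phi_def)
  also have "\<dots> \<le> E * ((x / E - 1)\<^sup>2 / 2)" using hfun_le_square[OF u] assms by (intro mult_left_mono) auto
  also have "\<dots> = (x - E)\<^sup>2 / (2 * E)" using assms by (simp add: power2_eq_square field_simps)
  finally show "2 * y * E \<le> (x - E)\<^sup>2" using assms by (simp add: field_simps)
qed

section \<open>Tail bounds for edge counts\<close>

lemma finite_pairs [simp]: "finite (pairs n)"
  by (rule finite_subset[of _ "{1..n} \<times> {1..n}"]) (auto simp: pairs_def)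

definition valid_prob :: "nat \<Rightarrow> (nat \<Rightarrow> nat \<Rightarrow> real) \<Rightarrow> bool" where
  "valid_prob n q \<longleftrightarrow> (\<forall>(i,j)\<in>pairs n. 0 \<le> q i j \<and> q i j \<le> 1)"

definition edge_mean :: "(nat \<Rightarrow> nat \<Rightarrow> real) \<Rightarrow> (nat \<times> nat) set \<Rightarrow> real" where
  "edge_mean q Q = (\<Sum>(i,j)\<in>Q. q i j)"

lemma graph_prob_nonneg: "valid_prob n q \<Longrightarrow> 0 \<le> graph_prob n q G"
  unfolding graph_prob_def by (rule prod_nonneg) (auto simp: valid_prob_def)

text \<open>Expanding the product of two-term sums, the graph \<open>G\<close> records the pairs at
  which the first term is chosen. Different choices of \<open>f\<close> yield the total mass, the
  edge means and the Laplace transforms of edge counts.\<close>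

lemma sum_graph_prob_prod:
  "(\<Sum>G\<in>Pow (pairs n). graph_prob n q G * prod f G)
     = (\<Prod>e\<in>pairs n. case_prod q e * f e + (1 - case_prod q e))"
proof -
  have "graph_prob n q G * prod f G
      = (\<Prod>e\<in>G. case_prod q e * f e) * (\<Prod>e\<in>pairs n - G. 1 - case_prod q e)"
    if "G \<subseteq> pairs n" for G
  proof -
    have "graph_prob n q G = (\<Prod>e\<in>pairs n. if e \<in> G then case_prod q e else 1 - case_prod q e)"
      unfolding graph_prob_def by (rule prod.cong) auto
    also have "\<dots> = (\<Prod>e\<in>pairs n \<inter> {e. e \<in> G}. case_prod q e)
        * (\<Prod>e\<in>pairs n \<inter> - {e. e \<in> G}. 1 - case_prod q e)"
      by (rule prod.If_cases) simp
    also have "pairs n \<inter> {e. e \<in> G} = G" using that by auto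
    also have "pairs n \<inter> - {e. e \<in> G} = pairs n - G" by auto
    finally show ?thesis by (simp add: prod.distrib)
  qed
  then show ?thesis by (simp add: prod_add)
qed

lemma sum_graph_prob: "(\<Sum>G\<in>Pow (pairs n). graph_prob n q G) = 1"
  using sum_graph_prob_prod[of n q "\<lambda>_. 1"] by simp

lemma expect_mem:
  assumes "e \<in> pairs n"
  shows "expect n q (\<lambda>G. of_bool (e \<in> G)) = case_prod q e"
proof -
  \<comment> \<open>With this choice \<open>prod f G\<close> is the indicator that \<open>e\<close>
    is absent from \<open>G\<close>.\<close>
  define f :: "nat \<times> nat \<Rightarrow> real" where "f x = of_bool (x \<noteq> e)" for x
  have f: "prod f G = 1 - of_bool (e \<in> G)" if "G \<in> Pow (pairs n)" for G
  proof (cases "e \<in> G")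
    case True
    have "finite G" using that by (auto intro: finite_subset)
    then show ?thesis using True by (simp add: f_def prod_zero_iff)
  next
    case False
    then have "prod f G = prod (\<lambda>_. 1) G" by (intro prod.cong) (auto simp: f_def)
    then show ?thesis using False by simp
  qed
  have "1 - expect n q (\<lambda>G. of_bool (e \<in> G)) = (\<Sum>G\<in>Pow (pairs n). graph_prob n q G * prod f G)"
    by (simp add: expect_def f right_diff_distrib sum_subtractf sum_graph_prob)
  also have "\<dots> = (\<Prod>x\<in>pairs n. if x = e then 1 - case_prod q e else 1)"
    unfolding sum_graph_prob_prod by (rule prod.cong) (auto simp: f_def)
  also have "\<dots> = 1 - case_prod q e" using assms by (simp add: prod.delta)
  finally show ?thesis by simp
qed

lemma expect_card:
  assumes "Q \<subseteq> pairs n"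
  shows "expect n q (\<lambda>G. real (card (G \<inter> Q))) = edge_mean q Q"
proof -
  have fin: "finite Q" using assms finite_subset[OF _ finite_pairs] by blast
  have "real (card (G \<inter> Q)) = (\<Sum>e\<in>Q. of_bool (e \<in> G))" for G
    using fin by (simp add: Int_commute)
  then have "expect n q (\<lambda>G. real (card (G \<inter> Q)))
      = (\<Sum>G\<in>Pow (pairs n). \<Sum>e\<in>Q. graph_prob n q G * of_bool (e \<in> G))"
    unfolding expect_def by (simp only: sum_distrib_left)
  also have "\<dots> = (\<Sum>e\<in>Q. expect n q (\<lambda>G. of_bool (e \<in> G)))"
    unfolding expect_def by (rule sum.swap)
  also have "\<dots> = edge_mean q Q"
    unfolding edge_mean_def using assms by (intro sum.cong) (auto simp: expect_mem)
  finally show ?thesis .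
qed

lemma prob_ev_nonneg: "valid_prob n q \<Longrightarrow> 0 \<le> prob_ev n q S"
  unfolding prob_ev_def by (intro sum_nonneg graph_prob_nonneg)

lemma finite_subgraphs [simp]: "finite {G. G \<subseteq> pairs n \<and> S G}"
  by (rule finite_subset[of _ "Pow (pairs n)"]) auto

lemma prob_ev_mono:
  assumes "valid_prob n q" "\<And>G. G \<subseteq> pairs n \<Longrightarrow> S G \<Longrightarrow> S' G"
  shows "prob_ev n q S \<le> prob_ev n q S'"
  unfolding prob_ev_def by (intro sum_mono2) (use assms in \<open>auto intro: graph_prob_nonneg\<close>)

lemma prob_ev_disj:
  assumes "valid_prob n q"
  shows "prob_ev n q (\<lambda>G. S G \<or> S' G) \<le> prob_ev n q S + prob_ev n q S'"
proof -
  have "prob_ev n q (\<lambda>G. S G \<or> S' G)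
      = (\<Sum>G\<in>{G. G \<subseteq> pairs n \<and> S G} \<union> {G. G \<subseteq> pairs n \<and> S' G}. graph_prob n q G)"
    unfolding prob_ev_def by (rule sum.cong) auto
  also have "\<dots> \<le> prob_ev n q S + prob_ev n q S'"
    unfolding prob_ev_def
    by (subst sum_Un) (auto intro!: sum_nonneg graph_prob_nonneg assms)
  finally show ?thesis .
qed

lemma prob_ev_Bex:
  assumes "valid_prob n q" "finite I"
  shows "prob_ev n q (\<lambda>G. \<exists>i\<in>I. S i G) \<le> (\<Sum>i\<in>I. prob_ev n q (S i))"
  using assms(2)
proof (induction I rule: finite_induct)
  case empty
  then show ?case by (simp add: prob_ev_def)
next
  case (insert i I)
  then show ?case using prob_ev_disj[OF assms(1), of "S i" "\<lambda>G. \<exists>i\<in>I. S i G"] by simp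
qed

text \<open>Exponential Markov inequality, with each Bernoulli factor bounded by its Poisson
  counterpart through \<open>1 + u <= exp u\<close>. The sign of \<open>l\<close> is left free, so
  both tails follow from it.\<close>

lemma prob_ev_exp_bound:
  assumes q: "valid_prob n q" and Q: "Q \<subseteq> pairs n"
    and S: "\<And>G. G \<subseteq> pairs n \<Longrightarrow> S G \<Longrightarrow> x \<le> l * real (card (G \<inter> Q))"
  shows "prob_ev n q S \<le> exp (edge_mean q Q * (exp l - 1) - x)"
proof -
  define f :: "nat \<times> nat \<Rightarrow> real" where "f e = (if e \<in> Q then exp l else 1)" for e
  have f: "prod f G = exp (l * real (card (G \<inter> Q)))" if "G \<subseteq> pairs n" for G
  proof -
    have "finite G" using that finite_subset[OF _ finite_pairs] by blast
    then have "prod f G = (\<Prod>e\<in>G \<inter> {e. e \<in> Q}. exp l) * (\<Prod>e\<in>G \<inter> - {e. e \<in> Q}. 1)"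
      unfolding f_def by (rule prod.If_cases)
    then show ?thesis by (simp add: mult.commute flip: exp_of_nat_mult)
  qed
  have "prob_ev n q S \<le> (\<Sum>G\<in>{G. G \<subseteq> pairs n \<and> S G}. graph_prob n q G * (prod f G * exp (- x)))"
    unfolding prob_ev_def
  proof (rule sum_mono)
    fix G assume "G \<in> {G. G \<subseteq> pairs n \<and> S G}"
    then have "1 \<le> prod f G * exp (- x)" using S[of G] f[of G] by (auto simp flip: exp_add)
    then have "graph_prob n q G * 1 \<le> graph_prob n q G * (prod f G * exp (- x))"
      using graph_prob_nonneg[OF q, of G] by (intro mult_left_mono)
    then show "graph_prob n q G \<le> graph_prob n q G * (prod f G * exp (- x))" by simp
  qed
  also have "\<dots> \<le> (\<Sum>G\<in>Pow (pairs n). graph_prob n q G * (prod f G * exp (- x)))"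
  proof (rule sum_mono2)
    show "0 \<le> graph_prob n q G * (prod f G * exp (- x))" for G
      by (intro mult_nonneg_nonneg prod_nonneg graph_prob_nonneg q) (auto simp: f_def)
  qed auto
  also have "\<dots> = (\<Prod>e\<in>pairs n. case_prod q e * f e + (1 - case_prod q e)) * exp (- x)"
    unfolding sum_graph_prob_prod[symmetric] by (simp only: sum_distrib_right mult.assoc)
  also have "(\<Prod>e\<in>pairs n. case_prod q e * f e + (1 - case_prod q e))
      \<le> (\<Prod>e\<in>pairs n. exp (case_prod q e * (f e - 1)))"
  proof (rule prod_mono)
    fix e assume "e \<in> pairs n"
    then have "0 \<le> case_prod q e" "case_prod q e \<le> 1" using q by (auto simp: valid_prob_def)
    moreover have "1 + case_prod q e * (f e - 1) \<le> exp (case_prod q e * (f e - 1))"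
      by (rule exp_ge_add_one_self)
    moreover have "0 \<le> case_prod q e * f e"
      using calculation(1) by (intro mult_nonneg_nonneg) (auto simp: f_def)
    ultimately show "0 \<le> case_prod q e * f e + (1 - case_prod q e) \<and>
        case_prod q e * f e + (1 - case_prod q e) \<le> exp (case_prod q e * (f e - 1))"
      unfolding right_diff_distrib mult_1_right by (intro conjI; linarith)
  qed
  also have "(\<Prod>e\<in>pairs n. exp (case_prod q e * (f e - 1)))
      = exp (\<Sum>e\<in>pairs n. case_prod q e * (f e - 1))"
    by (simp add: exp_sum)
  also have "(\<Sum>e\<in>pairs n. case_prod q e * (f e - 1)) = (\<Sum>e\<in>Q. case_prod q e * (f e - 1))"
    by (rule sum.mono_neutral_right) (use Q in \<open>auto simp: f_def\<close>)
  also have "\<dots> = edge_mean q Q * (exp l - 1)"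
    by (simp add: edge_mean_def f_def sum_distrib_right split_def)
  finally show ?thesis unfolding exp_add[symmetric] by simp
qed

lemma exp_neg_le: "0 \<le> l \<Longrightarrow> exp (- l) \<le> 1 - l + l\<^sup>2" for l :: real
proof -
  assume l: "0 \<le> l"
  have "exp (- l) \<le> 1 / (1 + l)"
    using exp_ge_add_one_self[of l] l by (simp add: exp_minus field_simps)
  also have "\<dots> \<le> 1 - l + l\<^sup>2"
    using l by (simp add: field_simps power2_eq_square)
  finally show ?thesis .
qed

text \<open>With \<open>exp l <= 1 + l + l^2\<close> on the unit interval the exponent becomes
  \<open>M * l^2 - l * a\<close>, which is minimal at \<open>l = a / (2 * M)\<close>; the bound
  \<open>a <= 2 * M\<close> keeps this \<open>l\<close> below 1. An upper bound \<open>M\<close> on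
  the mean is enough because \<open>exp l - 1\<close> is nonnegative.\<close>

lemma prob_ev_upper_tail:
  assumes q: "valid_prob n q" and Q: "Q \<subseteq> pairs n"
    and M: "edge_mean q Q \<le> M" "0 < M" and a: "0 \<le> a" "a \<le> 2 * M"
  shows "prob_ev n q (\<lambda>G. M + a \<le> real (card (G \<inter> Q))) \<le> exp (- a\<^sup>2 / (4 * M))"
proof -
  define l where "l = a / (2 * M)"
  have l: "0 \<le> l" "l \<le> 1" using M a by (auto simp: l_def)
  have "prob_ev n q (\<lambda>G. M + a \<le> real (card (G \<inter> Q)))
      \<le> exp (edge_mean q Q * (exp l - 1) - l * (M + a))"
    by (rule prob_ev_exp_bound[OF q Q]) (use l in \<open>auto intro: mult_left_mono\<close>)
  also have "edge_mean q Q * (exp l - 1) \<le> M * (l + l\<^sup>2)"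
    using M l exp_bound[OF l] by (intro mult_mono) auto
  also have "M * (l + l\<^sup>2) - l * (M + a) = - a\<^sup>2 / (4 * M)"
    using M by (simp add: l_def field_simps power2_eq_square)
  finally show ?thesis by simp
qed

text \<open>The same quadratic optimization with tilt \<open>- l\<close>. As
  \<open>exp (- l) - 1\<close> is nonpositive, \<open>M\<close> now has to bound the mean from
  below.\<close>

lemma prob_ev_lower_tail:
  assumes q: "valid_prob n q" and Q: "Q \<subseteq> pairs n"
    and M: "M \<le> edge_mean q Q" "0 < M" and a: "0 \<le> a" "a \<le> 2 * M"
  shows "prob_ev n q (\<lambda>G. real (card (G \<inter> Q)) \<le> M - a) \<le> exp (- a\<^sup>2 / (4 * M))"
proof -
  define l where "l = a / (2 * M)"
  have l: "0 \<le> l" "l \<le> 1" using M a by (auto simp: l_def)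
  have "prob_ev n q (\<lambda>G. real (card (G \<inter> Q)) \<le> M - a)
      \<le> exp (edge_mean q Q * (exp (- l) - 1) - (- l) * (M - a))"
    by (rule prob_ev_exp_bound[OF q Q]) (use l in \<open>auto intro: mult_left_mono\<close>)
  also have "edge_mean q Q * (exp (- l) - 1) \<le> M * (exp (- l) - 1)"
    using M l by (intro mult_right_mono_neg) auto
  also have "M * (exp (- l) - 1) \<le> M * (- l + l\<^sup>2)"
    using M l exp_neg_le[of l] by (intro mult_left_mono) auto
  also have "M * (- l + l\<^sup>2) - (- l) * (M - a) = - a\<^sup>2 / (4 * M)"
    using M by (simp add: l_def field_simps power2_eq_square)
  finally show ?thesis by simp
qed

text \<open>The least integer \<open>k\<close> whose exponent reaches \<open>y\<close> takes the
  place of an inverse of \<open>phi\<close>: the event forces at least \<open>k\<close> edges, and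
  the tilt \<open>ln (k / E)\<close> produces exactly \<open>- phi k E\<close>. If no such
  \<open>k\<close> exists, the event is impossible.\<close>

lemma prob_ev_phi_tail:
  assumes q: "valid_prob n q" and Q: "Q \<subseteq> pairs n"
    and E: "edge_mean q Q \<le> E" "0 < E" and y: "0 < y"
  shows "prob_ev n q (\<lambda>G. y \<le> phi (real (card (G \<inter> Q))) E) \<le> exp (- y)"
proof (cases "\<exists>k. y \<le> phi (real k) E")
  case False
  then have "prob_ev n q (\<lambda>G. y \<le> phi (real (card (G \<inter> Q))) E) = 0"
    by (simp add: prob_ev_def)
  then show ?thesis by simp
next
  case True
  define k where "k = (LEAST k. y \<le> phi (real k) E)"
  have k: "y \<le> phi (real k) E" unfolding k_def using True by (rule LeastI_ex)
  have Ek: "E < real k" using phi_gap(1)[OF E(2) y k] .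
  define l where "l = ln (real k / E)"
  have l: "0 \<le> l" "exp l = real k / E" using E Ek by (auto simp: l_def)
  have "prob_ev n q (\<lambda>G. y \<le> phi (real (card (G \<inter> Q))) E)
      \<le> exp (edge_mean q Q * (exp l - 1) - l * real k)"
  proof (rule prob_ev_exp_bound[OF q Q])
    fix G assume "y \<le> phi (real (card (G \<inter> Q))) E"
    then have "k \<le> card (G \<inter> Q)" unfolding k_def by (rule Least_le)
    then show "l * real k \<le> l * real (card (G \<inter> Q))" using l by (intro mult_left_mono) auto
  qed
  also have "edge_mean q Q * (exp l - 1) \<le> E * (exp l - 1)"
    using E l(1) by (intro mult_right_mono) auto
  also have "E * (exp l - 1) - l * real k = - phi (real k) E"
    using E Ek by (simp add: phi_above l l_def[symmetric] field_simps)
  also have "\<dots> \<le> - y" using k by simp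
  finally show ?thesis by simp
qed

section \<open>Edge counts and their means\<close>

definition in_pairs :: "nat \<Rightarrow> nat set \<Rightarrow> (nat \<times> nat) set" where
  "in_pairs n D = {(i,j)\<in>pairs n. i \<in> D \<and> j \<in> D}"

definition cut_pairs :: "nat \<Rightarrow> nat set \<Rightarrow> (nat \<times> nat) set" where
  "cut_pairs n D = {(i,j)\<in>pairs n. (i \<in> D) \<noteq> (j \<in> D)}"

lemma in_pairs_subset: "in_pairs n D \<subseteq> pairs n"
  and cut_pairs_subset: "cut_pairs n D \<subseteq> pairs n"
  by (auto simp: in_pairs_def cut_pairs_def)

lemma finite_in_pairs [simp]: "finite (in_pairs n D)"
  and finite_cut_pairs [simp]: "finite (cut_pairs n D)"
  by (auto intro: finite_subset[OF in_pairs_subset] finite_subset[OF cut_pairs_subset])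

lemma in_pairs_all: "in_pairs n {1..n} = pairs n"
  by (auto simp: in_pairs_def pairs_def)

lemma in_pairs_mono: "D \<subseteq> C \<Longrightarrow> in_pairs n D \<subseteq> in_pairs n C"
  by (auto simp: in_pairs_def)

lemma e_in_eq: "G \<subseteq> pairs n \<Longrightarrow> e_in G D = real (card (G \<inter> in_pairs n D))"
  unfolding e_in_def in_pairs_def by (intro arg_cong[of _ _ real] arg_cong[of _ _ card]) auto

lemma e_cut_eq: "G \<subseteq> pairs n \<Longrightarrow> e_cut G D = real (card (G \<inter> cut_pairs n D))"
  unfolding e_cut_def cut_pairs_def by (intro arg_cong[of _ _ real] arg_cong[of _ _ card]) auto

lemma e_all_eq: "G \<subseteq> pairs n \<Longrightarrow> e_all G = real (card (G \<inter> pairs n))"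
  unfolding e_all_def by (simp add: Int_absorb2)

lemma e_cut_le_e_all: "G \<subseteq> pairs n \<Longrightarrow> e_cut G D \<le> e_all G"
  unfolding e_cut_def e_all_def
  by (auto intro!: card_mono finite_subset[OF _ finite_pairs])

lemma expect_e_in: "expect n q (\<lambda>G. e_in G D) = edge_mean q (in_pairs n D)"
proof -
  have "expect n q (\<lambda>G. e_in G D) = expect n q (\<lambda>G. real (card (G \<inter> in_pairs n D)))"
    unfolding expect_def by (intro sum.cong) (auto simp: e_in_eq)
  then show ?thesis by (simp add: expect_card in_pairs_subset)
qed

text \<open>The square of the weight sum runs over \<open>D \<times> D\<close>, which splits into
  the pairs in order, their mirror images and the diagonal.\<close>

lemma edge_mean_null_in:
  assumes "D \<subseteq> {1..n}"
  shows "edge_mean (p_null th) (in_pairs n D) = ((sum th D)\<^sup>2 - (\<Sum>i\<in>D. (th i)\<^sup>2)) / 2"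
proof -
  have fin: "finite D" using assms by (rule finite_subset) simp
  define f where "f = (\<lambda>(i,j). th i * th j)"
  define U where "U = in_pairs n D"
  define W where "W = prod.swap ` U"
  define B where "B = (\<lambda>i. (i, i)) ` D"
  have "(sum th D)\<^sup>2 = sum f (D \<times> D)"
    by (simp add: power2_eq_square sum_product sum.cartesian_product f_def)
  also have "D \<times> D = U \<union> (W \<union> B)"
  proof (intro equalityI subsetI)
    fix e assume e: "e \<in> D \<times> D"
    obtain i j where ij: "e = (i, j)" by fastforce
    consider "i < j" | "j < i" | "i = j" by linarith
    then show "e \<in> U \<union> (W \<union> B)"
    proof cases
      case 1
      then show ?thesis using e ij assms by (auto simp: U_def in_pairs_def pairs_def)
    next
      case 2
      then have "(j, i) \<in> U" using e ij assms by (auto simp: U_def in_pairs_def pairs_def)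
      then have "e \<in> W" using ij by (auto simp: W_def image_iff intro!: bexI[of _ "(j, i)"])
      then show ?thesis by simp
    next
      case 3
      then show ?thesis using e ij by (auto simp: B_def)
    qed
  qed (auto simp: U_def W_def B_def in_pairs_def)
  also have "sum f \<dots> = sum f U + (sum f W + sum f B)"
  proof -
    have "finite U" "finite W" "finite B" using fin by (simp_all add: U_def W_def B_def)
    moreover have "U \<inter> (W \<union> B) = {}" "W \<inter> B = {}"
      by (auto simp: U_def W_def B_def in_pairs_def pairs_def)
    ultimately show ?thesis by (simp add: sum.union_disjoint)
  qed
  also have "sum f W = sum f U"
    unfolding W_def by (subst sum.reindex) (auto simp: f_def intro!: sum.cong)
  also have "sum f B = (\<Sum>i\<in>D. (th i)\<^sup>2)"
    unfolding B_def by (subst sum.reindex) (auto simp: f_def inj_on_def power2_eq_square)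
  also have "sum f U = edge_mean (p_null th) (in_pairs n D)"
    by (simp add: f_def U_def edge_mean_def p_null_def)
  finally show ?thesis by simp
qed

text \<open>The pairs inside \<open>C\<close> lie within \<open>D\<close>, within
  \<open>C - D\<close>, or across. The diagonal sums cancel in the difference, so the formula is
  exact. The part of the cut inside \<open>C\<close> is the part whose probabilities change under
  the planted law.\<close>

lemma edge_mean_null_cut_in:
  assumes "D \<subseteq> C" "C \<subseteq> {1..n}"
  shows "edge_mean (p_null th) (cut_pairs n D \<inter> in_pairs n C) = sum th D * (sum th C - sum th D)"
proof -
  have fin: "finite C" "finite D" using assms by (auto intro: finite_subset)
  let ?m = "edge_mean (p_null th)"
  have "in_pairs n C = in_pairs n D \<union> (in_pairs n (C - D) \<union> cut_pairs n D \<inter> in_pairs n C)"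
    using assms(1) by (auto simp: in_pairs_def cut_pairs_def)
  then have "?m (in_pairs n C)
      = ?m (in_pairs n D \<union> (in_pairs n (C - D) \<union> cut_pairs n D \<inter> in_pairs n C))" by simp
  also have "\<dots> = ?m (in_pairs n D) + ?m (in_pairs n (C - D) \<union> cut_pairs n D \<inter> in_pairs n C)"
    unfolding edge_mean_def
    by (rule sum.union_disjoint, simp, simp)
      (auto simp: in_pairs_def[of n D] in_pairs_def[of n "C - D"] cut_pairs_def)
  also have "?m (in_pairs n (C - D) \<union> cut_pairs n D \<inter> in_pairs n C)
      = ?m (in_pairs n (C - D)) + ?m (cut_pairs n D \<inter> in_pairs n C)"
    unfolding edge_mean_def
    by (rule sum.union_disjoint, simp, simp)
      (auto simp: in_pairs_def[of n D] in_pairs_def[of n "C - D"] cut_pairs_def)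
  finally have eq: "?m (cut_pairs n D \<inter> in_pairs n C)
      = ?m (in_pairs n C) - ?m (in_pairs n D) - ?m (in_pairs n (C - D))" by simp
  have diff: "sum th (C - D) = sum th C - sum th D"
    "(\<Sum>i\<in>C - D. (th i)\<^sup>2) = (\<Sum>i\<in>C. (th i)\<^sup>2) - (\<Sum>i\<in>D. (th i)\<^sup>2)"
    using assms fin by (auto simp: sum_diff)
  have sub: "C - D \<subseteq> {1..n}" "D \<subseteq> {1..n}" using assms by auto
  show ?thesis
    unfolding eq edge_mean_null_in[OF assms(2)] edge_mean_null_in[OF sub(1)]
      edge_mean_null_in[OF sub(2)] diff
    by (simp add: power2_eq_square field_simps)
qed

lemma edge_mean_null_cut:
  assumes "D \<subseteq> {1..n}"
  shows "edge_mean (p_null th) (cut_pairs n D) = sum th D * (sum th {1..n} - sum th D)"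
proof -
  have "cut_pairs n D \<inter> in_pairs n {1..n} = cut_pairs n D"
    unfolding in_pairs_all using cut_pairs_subset by blast
  then show ?thesis using edge_mean_null_cut_in[OF assms order_refl, of th] by simp
qed

lemma edge_mean_planted:
  assumes "Q \<subseteq> pairs n"
  shows "edge_mean (p_planted th rho C) Q
    = edge_mean (p_null th) Q + (rho - 1) * edge_mean (p_null th) (Q \<inter> in_pairs n C)"
proof -
  have fin: "finite Q" using assms finite_subset[OF _ finite_pairs] by blast
  have "edge_mean (p_null th) (Q \<inter> in_pairs n C)
      = (\<Sum>e\<in>Q. if e \<in> in_pairs n C then case_prod (p_null th) e else 0)"
    unfolding edge_mean_def by (rule sum.inter_restrict[OF fin])
  moreover have "edge_mean (p_planted th rho C) Q
      = (\<Sum>e\<in>Q. case_prod (p_null th) e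
          + (rho - 1) * (if e \<in> in_pairs n C then case_prod (p_null th) e else 0))"
    unfolding edge_mean_def using assms
    by (intro sum.cong) (auto simp: p_planted_def p_null_def in_pairs_def algebra_simps split: if_splits)
  ultimately show ?thesis
    by (simp add: sum.distrib sum_distrib_left edge_mean_def)
qed

section \<open>The estimator of the null mean\<close>

text \<open>The root \<open>sqrt (e - 2 c)\<close> is eliminated by completing a square:
  comparing it with \<open>sqrt e - g\<close> amounts to comparing \<open>c\<close> with \<open>g sqrt e - g\<^sup>2/2\<close>.
  The first comparison covers \<open>e < 2 c\<close>, where \<open>sqrt\<close> takes negative values.\<close>

lemma E_hat_ge:
  assumes "0 \<le> g" "g \<le> sqrt (e_all G)" "g * sqrt (e_all G) - g\<^sup>2 / 2 \<le> e_cut G D"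
  shows "g\<^sup>2 / 4 \<le> E_hat G D"
proof -
  have e: "0 \<le> e_all G" by (simp add: e_all_def)
  have "e_all G - 2 * e_cut G D \<le> (sqrt (e_all G) - g)\<^sup>2"
    using assms e by (simp add: power2_diff algebra_simps)
  then have "sqrt (e_all G - 2 * e_cut G D) \<le> sqrt (e_all G) - g"
    using assms real_sqrt_le_mono by fastforce
  then have "g\<^sup>2 \<le> (sqrt (e_all G) - sqrt (e_all G - 2 * e_cut G D))\<^sup>2"
    using assms by (intro power_mono) auto
  then show ?thesis by (simp add: E_hat_def)
qed

lemma E_hat_le:
  assumes "g \<le> sqrt (e_all G)" "e_cut G D \<le> g * sqrt (e_all G) - g\<^sup>2 / 2"
  shows "E_hat G D \<le> g\<^sup>2 / 4"
proof -
  have e: "0 \<le> e_all G" by (simp add: e_all_def)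
  have c: "0 \<le> e_cut G D" by (simp add: e_cut_def)
  have "(sqrt (e_all G) - g)\<^sup>2 \<le> e_all G - 2 * e_cut G D"
    using assms e by (simp add: power2_diff algebra_simps)
  then have "sqrt (e_all G) - g \<le> sqrt (e_all G - 2 * e_cut G D)"
    using assms real_le_rsqrt by blast
  moreover have "sqrt (e_all G - 2 * e_cut G D) \<le> sqrt (e_all G)" using c by simp
  ultimately have "(sqrt (e_all G) - sqrt (e_all G - 2 * e_cut G D))\<^sup>2 \<le> g\<^sup>2"
    by (intro power_mono) auto
  then show ?thesis by (simp add: E_hat_def)
qed

text \<open>For \<open>eta = 0\<close> the guess \<open>g = sqrt 2 * t\<close> satisfies
  \<open>g * sqrt e - g^2 / 2 = t * (S - t)\<close> exactly. Lowering it by the factor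
  \<open>1 - 4 * eta\<close> makes room for the errors in both counts. The bound uses an upper
  estimate of \<open>e(V)\<close> and a lower estimate of the cut.\<close>

lemma E_hat_lower:
  assumes G: "G \<subseteq> pairs n" and t: "0 < t" "4 * t \<le> S"
    and eta: "0 \<le> eta" "eta \<le> 1 / 8"
    and e: "e_all G \<le> S\<^sup>2 / 2 * (1 + eta)" and c: "(1 - eta) * (t * (S - t)) \<le> e_cut G D"
  shows "t\<^sup>2 / 2 * (1 - 4 * eta)\<^sup>2 \<le> E_hat G D"
proof -
  define z where "z = 4 * eta"
  define g where "g = sqrt 2 * (t * (1 - z))"
  have z: "0 \<le> z" "z \<le> 1 / 2" using eta by (auto simp: z_def)
  have e0: "0 \<le> e_all G" by (simp add: e_all_def)
  have g0: "0 \<le> g" using t z by (simp add: g_def)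
  have g2: "g\<^sup>2 = 2 * (t * (1 - z))\<^sup>2" by (simp add: g_def power_mult_distrib)
  then have g2': "g\<^sup>2 / 2 = (t * (1 - z))\<^sup>2" by simp
  have "(t * (1 - z))\<^sup>2 \<le> t\<^sup>2"
    using t z by (intro power_mono) (auto simp: mult_left_le)
  \<comment> \<open>The requirement \<open>g <= sqrt (e_all G)\<close> is obtained from the cut,
    which is itself a lower bound for \<open>e_all G\<close>.\<close>
  moreover have "2 * t\<^sup>2 \<le> (1 - eta) * (t * (S - t))"
  proof -
    have "2 * t\<^sup>2 \<le> (7/8) * (t * (3 * t))" by (simp add: power2_eq_square)
    also have "\<dots> \<le> (1 - eta) * (t * (S - t))"
      using t eta by (intro mult_mono) auto
    finally show ?thesis .
  qed
  moreover have "e_cut G D \<le> e_all G" using e_cut_le_e_all[OF G] .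
  ultimately have "g\<^sup>2 \<le> e_all G" using c g2 by linarith
  then have ge: "g \<le> sqrt (e_all G)" by (rule real_le_rsqrt)
  have "g * sqrt (e_all G) = t * (1 - z) * sqrt (2 * e_all G)"
    by (simp add: g_def real_sqrt_mult)
  also have "sqrt (2 * e_all G) \<le> S * (1 + eta)"
  proof (rule real_le_lsqrt)
    have "2 * e_all G \<le> S\<^sup>2 * (1 + eta)" using e by simp
    also have "\<dots> \<le> S\<^sup>2 * (1 + eta)\<^sup>2"
      using eta by (intro mult_left_mono) (auto simp: power2_eq_square algebra_simps)
    finally show "2 * e_all G \<le> (S * (1 + eta))\<^sup>2" by (simp add: power_mult_distrib)
  qed (use t eta e0 in auto)
  also have "t * (1 - z) * (S * (1 + eta)) - g\<^sup>2 / 2 \<le> (1 - eta) * (t * (S - t))"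
  proof -
    \<comment> \<open>This is the difference of the two sides after expansion;
      \<open>4 * t <= S\<close> makes its linear part nonnegative.\<close>
    have "0 \<le> t * (eta * (2 * S - 7 * t) + eta * (4 * eta * S + 16 * eta * t))"
      using t eta by (intro mult_nonneg_nonneg add_nonneg_nonneg) auto
    then show ?thesis
      unfolding g2' z_def by (simp add: power2_eq_square algebra_simps)
  qed
  finally have "g * sqrt (e_all G) - g\<^sup>2 / 2 \<le> e_cut G D"
    using c t z by (simp add: mult_left_mono)
  from E_hat_ge[OF g0 ge this] show ?thesis
    unfolding g2 z_def by (simp add: power_mult_distrib)
qed

text \<open>The mirror image of the lower bound, with the guess raised by the factor
  \<open>1 + 8 * eta\<close>. The second-order terms in \<open>eta\<close> now have the wrong sign,
  and the larger constant together with \<open>6 * t <= S\<close> absorbs them.\<close>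

lemma E_hat_upper:
  assumes t: "0 < t" "6 * t \<le> S"
    and eta: "0 \<le> eta" "eta \<le> 1 / 16"
    and e: "S\<^sup>2 / 2 * (1 - eta) \<le> e_all G" and c: "e_cut G D \<le> (1 + eta) * (t * (S - t))"
  shows "E_hat G D \<le> t\<^sup>2 / 2 * (1 + 8 * eta)\<^sup>2"
proof -
  define z where "z = 8 * eta"
  define g where "g = sqrt 2 * (t * (1 + z))"
  have z: "0 \<le> z" "z \<le> 1 / 2" using eta by (auto simp: z_def)
  have g2: "g\<^sup>2 = 2 * (t * (1 + z))\<^sup>2" by (simp add: g_def power_mult_distrib)
  then have g2': "g\<^sup>2 / 2 = (t * (1 + z))\<^sup>2" by simp
  have e2: "S * (1 - eta) \<le> sqrt (2 * e_all G)"
  proof (rule real_le_rsqrt)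
    have "(S * (1 - eta))\<^sup>2 = S\<^sup>2 * (1 - eta)\<^sup>2" by (simp add: power_mult_distrib)
    also have "\<dots> \<le> S\<^sup>2 * (1 - eta)"
      using eta by (intro mult_left_mono) (auto simp: power2_eq_square mult_left_le)
    also have "\<dots> \<le> 2 * e_all G" using e by simp
    finally show "(S * (1 - eta))\<^sup>2 \<le> 2 * e_all G" .
  qed
  have "g * 1 \<le> sqrt (e_all G)"
  proof -
    have "sqrt 2 * g = (sqrt 2 * sqrt 2) * (t * (1 + z))" by (simp only: g_def mult.assoc)
    then have "sqrt 2 * g = 2 * (t * (1 + z))" by simp
    also have "2 * (t * (1 + z)) \<le> 2 * (t * (3 / 2))" using t z by (intro mult_left_mono) auto
    also have "\<dots> \<le> S * (15 / 16)" using t by simp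
    also have "\<dots> \<le> S * (1 - eta)" using t eta by (intro mult_left_mono) auto
    also note e2
    also have "sqrt (2 * e_all G) = sqrt 2 * sqrt (e_all G)" by (simp add: real_sqrt_mult)
    finally show ?thesis by simp
  qed
  have "(1 + eta) * (t * (S - t)) \<le> t * (1 + z) * (S * (1 - eta)) - g\<^sup>2 / 2"
  proof -
    have "0 \<le> t * (eta * (6 * S - 15 * t) - eta * (8 * eta * S + 64 * eta * t))"
    proof -
      have "eta * S \<le> S / 16" "eta * t \<le> t / 16" using t eta by (auto intro: mult_right_mono[of eta "1/16", simplified])
      then have "8 * eta * S + 64 * eta * t \<le> 6 * S - 15 * t" using t by linarith
      then show ?thesis using t eta by (simp flip: right_diff_distrib)
    qed
    then show ?thesis
      unfolding g2' z_def by (simp add: power2_eq_square algebra_simps)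
  qed
  also have "t * (1 + z) * (S * (1 - eta)) \<le> t * (1 + z) * sqrt (2 * e_all G)"
    using t z e2 by (intro mult_left_mono) auto
  also have "\<dots> = g * sqrt (e_all G)" by (simp add: g_def real_sqrt_mult)
  finally have "e_cut G D \<le> g * sqrt (e_all G) - g\<^sup>2 / 2" using c by simp
  with \<open>g * 1 \<le> sqrt (e_all G)\<close> have "E_hat G D \<le> g\<^sup>2 / 4" by (intro E_hat_le) auto
  then show ?thesis
    unfolding g2 z_def by (simp add: power_mult_distrib)
qed

section \<open>Type I error\<close>

text \<open>The asymptotic hypotheses on the weights, with \<open>1 / A\<close> in place of \<open>o(1)\<close>.\<close>
locale rank_one_regime =
  fixes n r :: nat and th :: "nat \<Rightarrow> real" and A :: real
  assumes A: "64 \<le> A"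
    and th_range: "\<And>i. i \<in> {1..n} \<Longrightarrow> 0 < th i \<and> th i < 1"
    and r: "1 \<le> r" "r \<le> n"
    and log_large: "A \<le> ln (real n / real r)"
    and ratio_le_r: "A * (Max (th ` {1..n}) / Min (th ` {1..n}))\<^sup>2 \<le> real r powr (2/3)"
    and ratio_le_n: "A * (Max (th ` {1..n}) / Min (th ` {1..n}))\<^sup>2
        \<le> real n / real r * (Min (th ` {1..n}))\<^sup>2"
begin

section \<open>Weight sums and logarithms in the asymptotic regime\<close>

definition lo :: real where "lo = Min (th ` {1..n})"
definition hi :: real where "hi = Max (th ` {1..n})"
definition S :: real where "S = sum th {1..n}"
definition L :: "nat \<Rightarrow> real" where "L k = ln (real n / real k)"
definition E_floor :: "nat \<Rightarrow> real" where "E_floor k = (real k)\<^sup>2 / real n * (L k)^4"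

lemma n_pos: "0 < real n" and r_pos: "0 < real r"
  using r by auto

lemma lo_le: "i \<in> {1..n} \<Longrightarrow> lo \<le> th i" and le_hi: "i \<in> {1..n} \<Longrightarrow> th i \<le> hi"
  unfolding lo_def hi_def by auto

lemma lo_pos: "0 < lo" and hi_less: "hi < 1"
proof -
  have "{1..n} \<noteq> {}" using r by auto
  then show "0 < lo" "hi < 1"
    unfolding lo_def hi_def using th_range by auto
qed

lemma lo_le_hi: "lo \<le> hi"
  using lo_le[of 1] le_hi[of 1] r by force

lemma hi_pos: "0 < hi"
  using lo_pos lo_le_hi by linarith

lemma ratio_ge_1: "1 \<le> (hi / lo)\<^sup>2"
  using lo_pos lo_le_hi by simp

lemma A_ratio_n: "A * real r * (hi / lo)\<^sup>2 \<le> real n * lo\<^sup>2"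
  using ratio_le_n r_pos unfolding lo_def[symmetric] hi_def[symmetric]
  by (simp add: field_simps)

lemma A_r_le: "A * real r \<le> real n * lo\<^sup>2"
proof -
  have "A * real r * 1 \<le> A * real r * (hi / lo)\<^sup>2"
    using A r_pos ratio_ge_1 by (intro mult_left_mono) auto
  then show ?thesis using A_ratio_n by simp
qed

lemma A_le: "A \<le> real n * lo\<^sup>2"
proof -
  have "A * 1 \<le> A * real r" using A r by (intro mult_left_mono) auto
  then show ?thesis using A_r_le by simp
qed

text \<open>Multiplying \<open>A_ratio_n\<close> by \<open>lo^2\<close> leaves spare powers of
  \<open>lo\<close>, which are discarded using \<open>lo <= hi < 1\<close>. It follows that any set
  of at most \<open>r\<close> vertices carries a negligible share of the total weight
  \<open>S\<close>.\<close>

lemma A_r_hi_le: "A * (real r * hi) \<le> real n * lo"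
proof -
  have "A * real r * hi\<^sup>2 = A * real r * (hi / lo)\<^sup>2 * lo\<^sup>2"
    using lo_pos by (simp add: power_divide)
  also have "\<dots> \<le> real n * lo\<^sup>2 * lo\<^sup>2" using A_ratio_n by (intro mult_right_mono) auto
  also have "\<dots> = real n * lo * (lo * lo * lo)" by (simp add: power2_eq_square)
  also have "\<dots> \<le> real n * lo * (1 * 1 * hi)"
    using lo_pos lo_le_hi hi_less by (intro mult_left_mono mult_mono) auto
  finally have "(A * (real r * hi)) * hi \<le> (real n * lo) * hi"
    by (simp add: power2_eq_square)
  then show ?thesis using hi_pos mult_le_cancel_right_pos by blast
qed

lemma sum_th_bounds:
  assumes "D \<subseteq> {1..n}"
  shows "real (card D) * lo \<le> sum th D" "sum th D \<le> real (card D) * hi"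
  by (rule sum_bounded_below, use assms lo_le in blast)
    (rule sum_bounded_above, use assms le_hi in blast)

lemma sum_th_pos: "D \<subseteq> {1..n} \<Longrightarrow> D \<noteq> {} \<Longrightarrow> 0 < sum th D"
  using th_range by (intro sum_pos) (auto intro: finite_subset)

lemma sum_th_le_S: "D \<subseteq> {1..n} \<Longrightarrow> sum th D \<le> S"
  unfolding S_def using th_range by (intro sum_mono2) (auto simp: less_imp_le)

lemma S_ge: "real n * lo \<le> S"
  using sum_th_bounds(1)[of "{1..n}"] by (simp add: S_def)

lemma S_pos: "0 < S"
  using S_ge n_pos lo_pos by (meson less_le_trans mult_pos_pos)

lemma S_square_ge: "A * real n \<le> S\<^sup>2"
proof -
  have "A * real n \<le> (real n * lo\<^sup>2) * real n" using A_le by (intro mult_right_mono) auto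
  also have "\<dots> = (real n * lo)\<^sup>2" by (simp add: power2_eq_square)
  also have "\<dots> \<le> S\<^sup>2" using S_ge lo_pos by (intro power_mono) auto
  finally show ?thesis .
qed

lemma A_le_S_square: "A \<le> S\<^sup>2"
proof -
  have "A * 1 \<le> A * real n" using A n_pos by (intro mult_left_mono) auto
  then show ?thesis using S_square_ge by simp
qed

lemma A_sum_le_S:
  assumes "D \<subseteq> {1..n}" "card D \<le> r"
  shows "A * sum th D \<le> S"
proof -
  have "A * sum th D \<le> A * (real r * hi)"
  proof (rule mult_left_mono)
    have "sum th D \<le> real (card D) * hi" using sum_th_bounds assms by simp
    also have "\<dots> \<le> real r * hi" using assms hi_pos by (intro mult_right_mono) auto
    finally show "sum th D \<le> real r * hi" .
  qed (use A in simp)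
  then show ?thesis using A_r_hi_le S_ge by linarith
qed

lemma L_antimono: "1 \<le> k \<Longrightarrow> k \<le> l \<Longrightarrow> l \<le> n \<Longrightarrow> L l \<le> L k"
  unfolding L_def by (auto intro!: frac_le simp: field_simps)

lemma L_ge_A: "1 \<le> k \<Longrightarrow> k \<le> r \<Longrightarrow> A \<le> L k"
  using L_antimono[of k r] log_large r(2) unfolding L_def by linarith

lemma kL_ge_A: "1 \<le> k \<Longrightarrow> k \<le> r \<Longrightarrow> A \<le> real k * L k"
  using mult_mono[of 1 "real k" A "L k"] L_ge_A[of k] A by simp

lemma T_u_eq: "T_u n G D = phi (e_in G D) (E_tilde n G D) / (real (card D) * L (card D))"
  by (simp add: T_u_def phi_def L_def)

lemma E_tilde_eq: "E_tilde n G D = max (E_hat G D) (E_floor (card D))"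
  by (simp add: E_tilde_def E_floor_def L_def)

lemma E_floor_pos: "1 \<le> k \<Longrightarrow> k \<le> r \<Longrightarrow> 0 < E_floor k"
  using L_ge_A[of k] A n_pos by (simp add: E_floor_def)

lemma valid_null: "valid_prob n (p_null th)"
proof -
  have "0 \<le> th i * th j \<and> th i * th j \<le> 1" if "(i, j) \<in> pairs n" for i j
  proof -
    have "0 < th i \<and> th i < 1" "0 < th j \<and> th j < 1"
      using that th_range by (auto simp: pairs_def)
    then show ?thesis by (simp add: mult_le_one)
  qed
  then show ?thesis by (auto simp: valid_prob_def p_null_def)
qed

lemma edge_mean_null_in_le:
  "D \<subseteq> {1..n} \<Longrightarrow> edge_mean (p_null th) (in_pairs n D) \<le> (sum th D)\<^sup>2 / 2"
  by (simp add: edge_mean_null_in sum_nonneg)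

end

section \<open>Counting vertex sets for the union bound\<close>

lemma binomial_le_exp:
  assumes "1 \<le> k" "k \<le> n"
  shows "real (n choose k) \<le> exp (real k * (1 + ln (real n / real k)))"
proof -
  \<comment> \<open>The left side is a single term of the exponential series at
    \<open>k\<close>.\<close>
  have "real k ^ k / fact k \<le> exp (real k)"
  proof -
    have "(\<Sum>i\<in>{k}. real k ^ i /\<^sub>R fact i) \<le> (\<Sum>i. real k ^ i /\<^sub>R fact i)"
      by (rule sum_le_suminf[OF summable_exp_generic]) auto
    then show ?thesis by (simp add: exp_def divide_inverse mult.commute)
  qed
  then have k: "real k ^ k \<le> exp (real k) * fact k" by (simp add: field_simps)
  have "real (n choose k) * fact k \<le> real n ^ k"
    using binomial_fact_pow[of n k] by (metis of_nat_fact of_nat_le_iff of_nat_mult of_nat_power)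
  also have "\<dots> = (real n / real k) ^ k * real k ^ k" using assms by (simp add: power_divide)
  also have "\<dots> \<le> (real n / real k) ^ k * (exp (real k) * fact k)" using k by (intro mult_left_mono) auto
  finally have "real (n choose k) * fact k \<le> ((real n / real k) ^ k * exp (real k)) * fact k"
    by (simp only: mult.assoc)
  then have "real (n choose k) \<le> (real n / real k) ^ k * exp (real k)"
    by (rule mult_right_le_imp_le) simp
  also have "(real n / real k) ^ k = exp (real k * ln (real n / real k))"
    using assms by (simp add: exp_of_nat_mult)
  finally show ?thesis by (simp add: exp_add[symmetric] distrib_left add.commute)
qed

lemma sum_subsets_by_card:
  assumes "r \<le> n"
  shows "(\<Sum>D\<in>{D. D \<subseteq> {1..n} \<and> 1 \<le> card D \<and> card D \<le> r}. f (card D))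
    = (\<Sum>k=1..r. real (n choose k) * f k)"
proof -
  let ?X = "{D. D \<subseteq> {1..n} \<and> 1 \<le> card D \<and> card D \<le> r}"
  have fin: "finite ?X" by (rule finite_subset[of _ "Pow {1..n}"]) auto
  have "(\<Sum>D\<in>?X. f (card D)) = (\<Sum>k=1..r. \<Sum>D\<in>{D \<in> ?X. card D = k}. f (card D))"
    by (rule sum.group[symmetric, OF fin]) auto
  also have "\<dots> = (\<Sum>k=1..r. real (n choose k) * f k)"
  proof (rule sum.cong)
    fix k assume "k \<in> {1..r}"
    then have "{D \<in> ?X. card D = k} = {D. D \<subseteq> {1..n} \<and> card D = k}" by auto
    then show "(\<Sum>D\<in>{D \<in> ?X. card D = k}. f (card D)) = real (n choose k) * f k"
      using n_subsets[of "{1..n}" k] by simp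
  qed simp
  finally show ?thesis .
qed

lemma sum_power_le:
  fixes q :: real
  assumes "0 \<le> q" "q \<le> 1 / 2"
  shows "(\<Sum>k=1..r. q ^ k) \<le> 2 * q"
proof -
  have "(1 - q) * (\<Sum>k=1..r. q ^ k) = q - q ^ Suc r"
  proof (induction r)
    case (Suc r)
    have "(1 - q) * (\<Sum>k=1..Suc r. q ^ k) = (1 - q) * (\<Sum>k=1..r. q ^ k) + (1 - q) * q ^ Suc r"
      by (simp add: distrib_left)
    also note Suc.IH
    finally show ?case by (simp add: left_diff_distrib)
  qed simp
  then have "(1 - q) * (\<Sum>k=1..r. q ^ k) \<le> q" using assms by simp
  moreover have "(1 / 2) * (\<Sum>k=1..r. q ^ k) \<le> (1 - q) * (\<Sum>k=1..r. q ^ k)"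
    using assms by (intro mult_right_mono sum_nonneg) auto
  ultimately show ?thesis by linarith
qed

section \<open>Concentration under the null law\<close>

context rank_one_regime
begin

text \<open>The estimate of the expected number of edges in \<open>D\<close> only matters when it exceeds the
  floor of \<open>E_tilde\<close>; that forces \<open>D\<close> to be so heavy that its cut size concentrates.\<close>
lemma cut_mean_large:
  assumes D: "D \<subseteq> {1..n}" "1 \<le> card D" "card D \<le> r"
    and heavy: "E_floor (card D) \<le> (sum th D)\<^sup>2 / 2"
  shows "sqrt A * (real (card D) * L (card D)) \<le> sum th D * S"
proof -
  let ?k = "real (card D)" and ?t = "sum th D" and ?L = "L (card D)"
  have L: "1 \<le> ?L" using L_ge_A[of "card D"] D A by simp
  have "(sqrt A * (?k * ?L))\<^sup>2 = A * (?k\<^sup>2 * ?L\<^sup>2)" using A by (simp add: power_mult_distrib)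
  also have "\<dots> \<le> A * (?k\<^sup>2 * ?L^4)"
    using A L by (intro mult_left_mono power_increasing) auto
  \<comment> \<open>The factor \<open>1 / n\<close> in the floor is paid for by
    \<open>S_square_ge\<close>.\<close>
  also have "\<dots> = E_floor (card D) * (A * real n)" using n_pos by (simp add: E_floor_def)
  also have "\<dots> \<le> ?t\<^sup>2 * S\<^sup>2"
  proof (rule mult_mono)
    show "E_floor (card D) \<le> ?t\<^sup>2" using heavy by (smt (verit) zero_le_power2 field_sum_of_halves)
  qed (use S_square_ge A in auto)
  also have "\<dots> = (?t * S)\<^sup>2" by (simp add: power_mult_distrib)
  finally show ?thesis
  proof (rule power2_le_imp_le)
    have "0 < ?t" using D by (intro sum_th_pos) auto
    then show "0 \<le> ?t * S" using S_pos by simp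
  qed
qed

text \<open>The deterministic half of the first error bound: on the good event a rejection by
  \<open>D\<close> forces an atypical number of edges inside \<open>D\<close>, measured against a
  known bound on its null mean. The constant \<open>c\<close> satisfies
  \<open>(1 - 3 * c) * (1 + eps / 3) = 1 + eps / 6\<close>, so a loss of \<open>(1 - c)^3\<close> is
  affordable.\<close>

lemma null_threshold:
  fixes eps c eta :: real and D :: "nat set"
  defines "k \<equiv> real (card D)" and "t \<equiv> sum th D" and "l \<equiv> L (card D)"
  assumes D: "D \<subseteq> {1..n}" "1 \<le> card D" "card D \<le> r" and G: "G \<subseteq> pairs n"
    and eps: "0 < eps" and c: "c = eps / (6 * (3 + eps))"
    and eta: "eta = c / 16 * min 1 (sqrt (k * l) / t)"
    and e: "e_all G \<le> S\<^sup>2 / 2 * (1 + eta)"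
    and cut: "t\<^sup>2 / 2 \<le> E_floor (card D) \<or> (1 - eta) * (t * (S - t)) \<le> e_cut G D"
    and T: "1 + eps / 3 \<le> T_u n G D"
  shows "(1 + eps / 6) * (k * l) \<le> phi (e_in G D) (max (t\<^sup>2 / 2) (E_floor (card D)))"
proof -
  have kl: "0 < k * l" using kL_ge_A[of "card D"] D A by (simp add: k_def l_def)
  have t: "0 < t" unfolding t_def using D by (intro sum_th_pos) auto
  have c01: "0 < c" "c \<le> 1 / 6" using eps by (auto simp: c field_simps)
  have floor: "0 < E_floor (card D)" using E_floor_pos D by simp
  define y where "y = (1 + eps / 3) * (k * l)"
  have "0 < 1 + eps / 3" using eps by simp
  then have y: "0 < y" using kl unfolding y_def by (rule mult_pos_pos)
  have kl_y: "k * l \<le> y" using kl eps by (simp add: y_def distrib_right)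
  have "y \<le> T_u n G D * (k * l)" using T kl unfolding y_def by (intro mult_right_mono) auto
  also have "\<dots> = phi (e_in G D) (E_tilde n G D)"
    using kl unfolding T_u_eq k_def[symmetric] l_def[symmetric] by auto
  finally have yphi: "y \<le> phi (e_in G D) (E_tilde n G D)" .
  have y': "(1 + eps / 6) * (k * l) \<le> y"
    unfolding y_def using kl eps by (intro mult_right_mono) auto
  show ?thesis
  proof (cases "t\<^sup>2 / 2 \<le> E_floor (card D)")
    case True
    \<comment> \<open>For light \<open>D\<close> the floor alone bounds \<open>E_tilde\<close> from
      below, whatever the estimator does.\<close>
    have "phi (e_in G D) (E_tilde n G D) \<le> phi (e_in G D) (E_floor (card D))"
      using floor by (intro phi_antimono) (auto simp: E_tilde_eq)
    then show ?thesis using True yphi y' by (simp add: max_def)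
  next
    case False
    define s where "s = c * min 1 (sqrt (k * l) / t)"
    \<comment> \<open>A guaranteed lower bound for the estimator: the error \<open>4 * eta\<close>
      in the root is \<open>s / 4\<close>, and \<open>(1 + s) * (1 - s / 4)^2\<close> is at least
      1.\<close>
    define E where "E = t\<^sup>2 / 2 / (1 + s)"
    have s: "0 < s" "s \<le> c" using c01 kl t by (auto simp: s_def mult_left_le)
    have s1: "s \<le> 1 / 6" using s c01 by simp
    have eta_s: "eta = s / 16" by (simp add: eta s_def)
    have E: "0 < E" "t\<^sup>2 / 2 = (1 + s) * E" using t s by (simp_all add: E_def field_simps)
    have "4 * t \<le> A * t" using A t by simp
    then have "4 * t \<le> S" using A_sum_le_S[of D] D by (simp add: t_def)
    then have hat: "t\<^sup>2 / 2 * (1 - 4 * eta)\<^sup>2 \<le> E_hat G D"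
      using E_hat_lower[OF G t, of S eta] e cut False s s1 by (simp add: eta_s)
    have "1 \<le> (1 + s) * (1 - s / 4)\<^sup>2"
    proof -
      have "(1 + s) * (1 - s / 4)\<^sup>2 = 1 + s * (1 / 2 - 7 / 16 * s + s\<^sup>2 / 16)"
        by (simp add: power2_eq_square field_simps)
      moreover have "0 \<le> s * (1 / 2 - 7 / 16 * s + s\<^sup>2 / 16)"
        using s s1 by (intro mult_nonneg_nonneg add_nonneg_nonneg) auto
      ultimately show ?thesis by simp
    qed
    then have "E * 1 \<le> E * ((1 + s) * (1 - s / 4)\<^sup>2)" using E by (intro mult_left_mono) auto
    also have "\<dots> = t\<^sup>2 / 2 * (1 - 4 * eta)\<^sup>2" unfolding E(2) by (simp add: eta_s)
    finally have "E \<le> E_tilde n G D" using hat by (simp add: E_tilde_eq)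
    then have yE: "y \<le> phi (e_in G D) E"
      using yphi phi_antimono[OF E(1)] order_trans by blast
    note gap = phi_gap[OF E(1) y yE]
    \<comment> \<open>The gap \<open>s * E\<close> between \<open>E\<close> and
      \<open>t^2 / 2\<close> is small against the excess: \<open>s <= c * sqrt (k * l) / t\<close>
      bounds it on the scale that \<open>phi_gap\<close> guarantees for the excess.\<close>
    have "s * E \<le> c * (e_in G D - E)"
    proof (rule power2_le_imp_le)
      have "s\<^sup>2 * E \<le> s\<^sup>2 * (t\<^sup>2 / 2)" using s E by (intro mult_left_mono) auto
      also have "\<dots> \<le> (c * (sqrt (k * l) / t))\<^sup>2 * (t\<^sup>2 / 2)"
      proof (intro mult_right_mono power_mono)
        show "s \<le> c * (sqrt (k * l) / t)" unfolding s_def using c01 by (intro mult_left_mono) auto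
      qed (use s in auto)
      also have "\<dots> = c\<^sup>2 * (k * l / 2)" using kl t by (simp add: power_mult_distrib power_divide)
      also have "\<dots> \<le> c\<^sup>2 * (2 * y)" using y kl_y kl c01 by (intro mult_left_mono) auto
      finally have "s\<^sup>2 * E * E \<le> c\<^sup>2 * (2 * y) * E" using E by (intro mult_right_mono) auto
      also have "\<dots> = c\<^sup>2 * (2 * y * E)" by simp
      also have "\<dots> \<le> c\<^sup>2 * (e_in G D - E)\<^sup>2" using gap by (intro mult_left_mono) auto
      finally show "(s * E)\<^sup>2 \<le> (c * (e_in G D - E))\<^sup>2" by (simp add: power2_eq_square ac_simps)
    qed (use gap c01 in auto)
    then have "(1 - c) * (e_in G D - E) \<le> e_in G D - t\<^sup>2 / 2"
      unfolding E(2) by (simp add: algebra_simps)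
    then have pert: "(1 - c)^3 * phi (e_in G D) E \<le> phi (e_in G D) (t\<^sup>2 / 2)"
      using E s c01 gap by (intro phi_perturb) (auto intro!: mult_right_mono)
    have "(1 + eps / 6) * (k * l) = (1 - 3 * c) * y"
      using eps by (simp add: y_def c field_simps)
    also have "\<dots> \<le> (1 - c)^3 * y"
    proof (rule mult_right_mono)
      have "(1 - c)^3 = 1 - 3 * c + c\<^sup>2 * (3 - c)"
        by (simp add: power3_eq_cube power2_eq_square algebra_simps)
      then show "1 - 3 * c \<le> (1 - c)^3" using c01 by simp
    qed (use y in simp)
    also have "\<dots> \<le> (1 - c)^3 * phi (e_in G D) E" using yE c01 by (intro mult_left_mono) auto
    finally show ?thesis using pert False by (simp add: max_def)
  qed
qed

text \<open>A rejection implies that the total count, the cut of some \<open>D\<close>, or the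
  inside count of some \<open>D\<close> is atypical. The first event is handled once; the other two
  are summed over all \<open>D\<close>, each with probability at most \<open>exp (- y D)\<close>,
  which beats the number of sets of that size.\<close>

lemma type_I_error:
  fixes eps c :: real
  assumes eps: "0 < eps" and c: "c = eps / (6 * (3 + eps))"
    and A_eps: "12 \<le> A * eps" and A_c: "2048 * (1 + eps / 6) / c\<^sup>2 \<le> sqrt A"
  shows "prob_ev n (p_null th) (scan_test n r eps) \<le> exp (- c\<^sup>2 * A / 2048) + 4 * exp (1 - eps * A / 6)"
proof -
  define DD where "DD = {D. D \<subseteq> {1..n} \<and> 1 \<le> card D \<and> card D \<le> r}"
  have finDD: "finite DD" by (rule finite_subset[of _ "Pow {1..n}"]) (auto simp: DD_def)
  have c01: "0 < c" "c \<le> 1 / 6" using eps by (auto simp: c field_simps)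
  \<comment> \<open>One precision for \<open>e(V)\<close> that serves every \<open>D\<close>: it
    lies below all \<open>eta D\<close>, since \<open>|D| * L |D|\<close> is at least
    \<open>A\<close> and the weight of \<open>D\<close> is at most \<open>S\<close>.\<close>
  define b where "b = c / 16 * (sqrt A / S)"
  define eta where "eta D = c / 16 * min 1 (sqrt (real (card D) * L (card D)) / sum th D)" for D :: "nat set"
  define EE where "EE D = max ((sum th D)\<^sup>2 / 2) (E_floor (card D))" for D :: "nat set"
  define y where "y D = (1 + eps / 6) * (real (card D) * L (card D))" for D :: "nat set"
  define bad_e where "bad_e G \<longleftrightarrow> S\<^sup>2 / 2 + S\<^sup>2 / 2 * b \<le> real (card (G \<inter> pairs n))" for G
  define bad_cut where "bad_cut D G \<longleftrightarrow> E_floor (card D) < (sum th D)\<^sup>2 / 2 \<and>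
    real (card (G \<inter> cut_pairs n D)) \<le> sum th D * (S - sum th D) - eta D * (sum th D * (S - sum th D))" for D G
  define bad_in where "bad_in D G \<longleftrightarrow> y D \<le> phi (real (card (G \<inter> in_pairs n D))) (EE D)" for D G
  have sqrtA: "sqrt A \<le> S" using A_le_S_square S_pos by (simp add: real_le_lsqrt)
  have b: "0 \<le> b" "b \<le> 1"
  proof -
    have "c / 16 * (sqrt A / S) \<le> 1 * 1" using c01 S_pos A sqrtA by (intro mult_mono) auto
    then show "0 \<le> b" "b \<le> 1" using c01 S_pos A by (auto simp: b_def)
  qed
  have D_facts: "0 < sum th D" "A * sum th D \<le> S" "0 < real (card D) * L (card D)"
      "A \<le> real (card D) * L (card D)" "0 < EE D" "0 < y D" "0 < eta D" "eta D \<le> 1 / 16"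
    if "D \<in> DD" for D
  proof -
    have D: "D \<subseteq> {1..n}" "1 \<le> card D" "card D \<le> r" using that by (auto simp: DD_def)
    show t: "0 < sum th D" using D by (intro sum_th_pos) auto
    show "A * sum th D \<le> S" using A_sum_le_S D by simp
    show "A \<le> real (card D) * L (card D)" using kL_ge_A D by simp
    then show kl: "0 < real (card D) * L (card D)" using A by linarith
    then show "0 < y D" using eps by (simp add: y_def)
    show "0 < EE D" using E_floor_pos[of "card D"] D by (simp add: EE_def less_max_iff_disj)
    show "0 < eta D" using c01 kl t by (simp add: eta_def)
    have "eta D \<le> c / 16 * 1" unfolding eta_def using c01 by (intro mult_left_mono) auto
    then show "eta D \<le> 1 / 16" using c01 by simp
  qed
  have b_eta: "b \<le> eta D" if "D \<in> DD" for D
  proof -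
    note f = D_facts[OF that]
    have "sqrt A * sum th D \<le> sqrt (real (card D) * L (card D)) * S"
    proof (rule mult_mono)
      show "sum th D \<le> S" using sum_th_le_S that by (simp add: DD_def)
    qed (use f A in auto)
    then have "sqrt A / S \<le> sqrt (real (card D) * L (card D)) / sum th D"
      using f S_pos by (simp add: field_simps)
    then show ?thesis
      unfolding b_def eta_def using c01 sqrtA S_pos by (intro mult_left_mono) auto
  qed
  have cover: "bad_e G \<or> (\<exists>D\<in>DD. bad_cut D G \<or> bad_in D G)"
    if G: "G \<subseteq> pairs n" and scan: "scan_test n r eps G" for G
  proof (rule ccontr)
    assume good: "\<not> (bad_e G \<or> (\<exists>D\<in>DD. bad_cut D G \<or> bad_in D G))"
    define TT where "TT = {T_u n G D | D. D \<subseteq> {1..n} \<and> real r powr (1/3) \<le> real (card D) \<and> card D \<le> r}"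
    have "TT \<subseteq> T_u n G ` Pow {1..n}" by (auto simp: TT_def)
    then have finTT: "finite TT" by (rule finite_subset) simp
    \<comment> \<open>The set \<open>{1..r}\<close> is an admissible candidate, so the scan maximum
      is taken over a nonempty finite set and is attained.\<close>
    have "real r powr (1/3) \<le> real r powr 1" using r by (intro powr_mono) auto
    then have "T_u n G {1..r} \<in> TT" using r by (auto simp: TT_def intro!: exI[of _ "{1..r}"])
    then have "Max TT \<in> TT" using finTT by (intro Max_in) auto
    then obtain D where D: "D \<subseteq> {1..n}" "real r powr (1/3) \<le> real (card D)" "card D \<le> r"
      and T: "Max TT = T_u n G D" unfolding TT_def mem_Collect_eq by blast
    have "0 < real r powr (1/3)" using r by simp
    then have "0 < real (card D)" using D(2) by linarith
    then have D1: "1 \<le> card D" by simp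
    then have DDD: "D \<in> DD" using D by (simp add: DD_def)
    note f = D_facts[OF DDD]
    have "1 + eps / 3 \<le> T_u n G D"
      using scan T by (simp add: scan_test_def T_stat_def TT_def)
    moreover have "e_all G \<le> S\<^sup>2 / 2 * (1 + eta D)"
    proof -
      have "e_all G \<le> S\<^sup>2 / 2 * (1 + b)"
        using good e_all_eq[OF G] by (simp add: bad_e_def distrib_left)
      also have "\<dots> \<le> S\<^sup>2 / 2 * (1 + eta D)" using b_eta[OF DDD] by (intro mult_left_mono) auto
      finally show ?thesis .
    qed
    moreover have "(sum th D)\<^sup>2 / 2 \<le> E_floor (card D) \<or>
        (1 - eta D) * (sum th D * (S - sum th D)) \<le> e_cut G D"
      using good DDD e_cut_eq[OF G, of D] by (fastforce simp: bad_cut_def algebra_simps)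
    ultimately have "y D \<le> phi (e_in G D) (EE D)"
      unfolding y_def EE_def
      by (intro null_threshold[OF D(1) D1 D(3) G eps c eta_def])
    then have "bad_in D G" using e_in_eq[OF G] by (simp add: bad_in_def)
    then show False using good DDD by blast
  qed
  have P_e: "prob_ev n (p_null th) bad_e \<le> exp (- c\<^sup>2 * A / 2048)"
  proof -
    have "prob_ev n (p_null th) bad_e \<le> exp (- (S\<^sup>2 / 2 * b)\<^sup>2 / (4 * (S\<^sup>2 / 2)))"
      unfolding bad_e_def
    proof (rule prob_ev_upper_tail[OF valid_null order_refl])
      show "edge_mean (p_null th) (pairs n) \<le> S\<^sup>2 / 2"
        using edge_mean_null_in_le[of "{1..n}"] unfolding in_pairs_all S_def by simp
    qed (use S_pos b in auto)
    also have "- (S\<^sup>2 / 2 * b)\<^sup>2 / (4 * (S\<^sup>2 / 2)) = - c\<^sup>2 * A / 2048"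
    proof -
      have "S\<^sup>2 * b\<^sup>2 = (c / 16 * sqrt A)\<^sup>2"
        using S_pos unfolding power_mult_distrib[symmetric] by (simp add: b_def)
      also have "\<dots> = c\<^sup>2 * A / 256" using A by (simp add: power_mult_distrib power_divide)
      finally have "S\<^sup>2 * b\<^sup>2 = c\<^sup>2 * A / 256" .
      moreover have "- (S\<^sup>2 / 2 * b)\<^sup>2 / (4 * (S\<^sup>2 / 2)) = - (S\<^sup>2 * b\<^sup>2) / 8"
        using S_pos by (simp add: power2_eq_square field_simps)
      ultimately show ?thesis by simp
    qed
    finally show ?thesis .
  qed
  have P_in: "prob_ev n (p_null th) (bad_in D) \<le> exp (- y D)" if "D \<in> DD" for D
    unfolding bad_in_def
  proof (rule prob_ev_phi_tail[OF valid_null in_pairs_subset])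
    have "edge_mean (p_null th) (in_pairs n D) \<le> (sum th D)\<^sup>2 / 2"
      using edge_mean_null_in_le that by (simp add: DD_def)
    then show "edge_mean (p_null th) (in_pairs n D) \<le> EE D" by (simp add: EE_def)
  qed (use D_facts[OF that] in auto)
  have P_cut: "prob_ev n (p_null th) (bad_cut D) \<le> exp (- y D)" if "D \<in> DD" for D
  proof (cases "E_floor (card D) < (sum th D)\<^sup>2 / 2")
    case False
    then show ?thesis by (simp add: prob_ev_def bad_cut_def)
  next
    case True
    have D: "D \<subseteq> {1..n}" "1 \<le> card D" "card D \<le> r" using that by (auto simp: DD_def)
    note f = D_facts[OF that]
    define t where "t = sum th D"
    define kl where "kl = real (card D) * L (card D)"
    define m where "m = t * (S - t)"
    have t: "0 < t" "A * t \<le> S" and kl: "0 < kl" using f by (auto simp: t_def kl_def)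
    have "64 * t \<le> A * t" using A t by simp
    then have "t * (S / 2) \<le> t * (S - t)" using t by (intro mult_left_mono) linarith+
    then have m: "t * S / 2 \<le> m" by (simp add: m_def)
    have m0: "0 < m" using m t S_pos by (meson less_le_trans half_gt_zero mult_pos_pos)
    have "prob_ev n (p_null th) (bad_cut D)
        \<le> prob_ev n (p_null th) (\<lambda>G. real (card (G \<inter> cut_pairs n D)) \<le> m - eta D * m)"
      by (rule prob_ev_mono[OF valid_null]) (auto simp: bad_cut_def m_def t_def)
    also have "\<dots> \<le> exp (- (eta D * m)\<^sup>2 / (4 * m))"
    proof (rule prob_ev_lower_tail[OF valid_null cut_pairs_subset])
      show "m \<le> edge_mean (p_null th) (cut_pairs n D)"
        using D by (simp add: edge_mean_null_cut m_def t_def S_def)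
      show "0 \<le> eta D * m" "eta D * m \<le> 2 * m" using f m0 by auto
    qed (use m0 in simp)
    also have "- (eta D * m)\<^sup>2 / (4 * m) = - ((eta D)\<^sup>2 * m / 4)"
      using m0 by (simp add: power2_eq_square)
    also have "\<dots> \<le> - y D"
    proof -
      have eta2: "(eta D)\<^sup>2 = c\<^sup>2 / 256 * min 1 (kl / t\<^sup>2)"
      proof (cases "sqrt kl / t \<le> 1")
        case True
        then have "(sqrt kl / t)\<^sup>2 \<le> 1\<^sup>2" using t kl by (intro power_mono) auto
        then show ?thesis using True kl
          by (simp add: eta_def t_def[symmetric] kl_def[symmetric] power_mult_distrib power_divide)
      next
        case False
        then have "1\<^sup>2 \<le> (sqrt kl / t)\<^sup>2" by (intro power_mono) auto
        then show ?thesis using False kl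
          by (simp add: eta_def t_def[symmetric] kl_def[symmetric] power_mult_distrib power_divide)
      qed
      \<comment> \<open>If the minimum is 1, the floor condition is what makes the cut mean large
        enough. Otherwise the product is \<open>kl * S / t\<close>, and \<open>A * t <= S\<close>
        suffices.\<close>
      have "sqrt A * kl \<le> min 1 (kl / t\<^sup>2) * (t * S)"
      proof (cases "1 \<le> kl / t\<^sup>2")
        case True
        then show ?thesis
          using cut_mean_large[OF D] \<open>E_floor (card D) < (sum th D)\<^sup>2 / 2\<close> by (simp add: kl_def t_def)
      next
        case False
        have "sqrt A \<le> A" using A by (intro real_le_lsqrt) (auto simp: power2_eq_square)
        then have "sqrt A * t \<le> A * t" using t by (intro mult_right_mono) auto
        then have "sqrt A * t \<le> S" using t by linarith
        then have "kl * (sqrt A * t) \<le> kl * S" using kl by (intro mult_left_mono) auto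
        then show ?thesis using False t by (simp add: field_simps power2_eq_square)
      qed
      then have "c\<^sup>2 / 256 * (sqrt A * kl) \<le> c\<^sup>2 / 256 * (min 1 (kl / t\<^sup>2) * (t * S))"
        by (intro mult_left_mono) auto
      also have "\<dots> = (eta D)\<^sup>2 * (t * S)" by (simp add: eta2)
      also have "\<dots> \<le> (eta D)\<^sup>2 * (2 * m)" using m by (intro mult_left_mono) auto
      finally have "c\<^sup>2 / 2048 * sqrt A * kl \<le> (eta D)\<^sup>2 * m / 4" by (simp add: mult_ac)
      moreover have "(1 + eps / 6) * kl \<le> c\<^sup>2 / 2048 * sqrt A * kl"
        using A_c c01 kl by (intro mult_right_mono) (auto simp: field_simps)
      ultimately have "(1 + eps / 6) * kl \<le> (eta D)\<^sup>2 * m / 4" by linarith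
      then show ?thesis by (simp add: y_def kl_def)
    qed
    finally show ?thesis by simp
  qed
  \<comment> \<open>The binomial coefficient contributes \<open>exp (k * (1 + L k))\<close>, so only
    the surplus \<open>eps / 6\<close> in \<open>y\<close> remains and each size \<open>k\<close>
    costs at most \<open>q ^ k\<close>.\<close>
  define q where "q = exp (1 - eps * A / 6)"
  have q: "0 \<le> q" "q \<le> 1 / 2"
  proof -
    have "q \<le> exp (- 1)" using A_eps by (simp add: q_def mult.commute)
    also have "exp (- 1) \<le> (1 / 2 :: real)"
      using exp_ge_add_one_self[of 1] by (simp add: exp_minus field_simps)
    finally show "q \<le> 1 / 2" .
  qed (simp add: q_def)
  have "(\<Sum>D\<in>DD. exp (- y D)) = (\<Sum>k=1..r. real (n choose k) * exp (- ((1 + eps / 6) * (real k * L k))))"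
    unfolding y_def DD_def using sum_subsets_by_card[OF r(2), of "\<lambda>k. exp (- ((1 + eps / 6) * (real k * L k)))"] by simp
  also have "\<dots> \<le> (\<Sum>k=1..r. q ^ k)"
  proof (rule sum_mono)
    fix k assume k: "k \<in> {1..r}"
    have "real (n choose k) * exp (- ((1 + eps / 6) * (real k * L k)))
        \<le> exp (real k * (1 + L k)) * exp (- ((1 + eps / 6) * (real k * L k)))"
      using binomial_le_exp[of k n] k r by (intro mult_right_mono) (auto simp: L_def)
    also have "\<dots> = exp (real k * (1 - eps * L k / 6))"
      by (simp add: algebra_simps flip: exp_add)
    also have "\<dots> \<le> exp (real k * (1 - eps * A / 6))"
      using L_ge_A[of k] k eps by (simp add: mult_left_mono)
    also have "\<dots> = q ^ k" by (simp add: q_def exp_of_nat_mult)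
    finally show "real (n choose k) * exp (- ((1 + eps / 6) * (real k * L k))) \<le> q ^ k" .
  qed
  also have "\<dots> \<le> 2 * q" using sum_power_le[OF q] .
  finally have sum_y: "(\<Sum>D\<in>DD. exp (- y D)) \<le> 2 * q" .
  have "prob_ev n (p_null th) (scan_test n r eps)
      \<le> prob_ev n (p_null th) (\<lambda>G. bad_e G \<or> (\<exists>D\<in>DD. bad_cut D G \<or> bad_in D G))"
    using cover by (intro prob_ev_mono[OF valid_null]) auto
  also have "\<dots> \<le> prob_ev n (p_null th) bad_e
      + prob_ev n (p_null th) (\<lambda>G. \<exists>D\<in>DD. bad_cut D G \<or> bad_in D G)"
    by (rule prob_ev_disj[OF valid_null])
  also have "prob_ev n (p_null th) (\<lambda>G. \<exists>D\<in>DD. bad_cut D G \<or> bad_in D G)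
      \<le> (\<Sum>D\<in>DD. prob_ev n (p_null th) (\<lambda>G. bad_cut D G \<or> bad_in D G))"
    by (rule prob_ev_Bex[OF valid_null finDD])
  also have "\<dots> \<le> (\<Sum>D\<in>DD. 2 * exp (- y D))"
  proof (rule sum_mono)
    fix D assume "D \<in> DD"
    then show "prob_ev n (p_null th) (\<lambda>G. bad_cut D G \<or> bad_in D G) \<le> 2 * exp (- y D)"
      using prob_ev_disj[OF valid_null, of "bad_cut D" "bad_in D"] P_cut[of D] P_in[of D] by simp
  qed
  also have "\<dots> \<le> 4 * q" using sum_y by (simp flip: sum_distrib_left)
  finally show ?thesis using P_e by (simp add: q_def)
qed

end

section \<open>Type II error\<close>

text \<open>The comparison case of constant weights: taken at \<open>lo\<close> it bounds the mean
  inside \<open>C\<close> from below, taken at \<open>hi\<close> the mean inside \<open>D\<close>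
  from above.\<close>

lemma edge_mean_null_const:
  assumes "D \<subseteq> {1..n}"
  shows "edge_mean (p_null (\<lambda>_. a)) (in_pairs n D) = real (card D) * (real (card D) - 1) * a\<^sup>2 / 2"
  unfolding edge_mean_null_in[OF assms] by (simp add: power2_eq_square algebra_simps)

text \<open>\<open>D\<close> stands for the maximizer inside \<open>C\<close>, and
  \<open>D_max\<close> records its comparison with \<open>C\<close> itself. \<open>kap\<close> is
  the relative loss to be shared among the diagonal bias, the estimator and the random fluctuations.
  \<open>A_log\<close> lets \<open>l\<close> outweigh powers of itself inside a logarithm.\<close>

locale planted_regime = rank_one_regime +
  fixes C D :: "nat set" and rho eps kap :: real
  assumes C: "C \<subseteq> {1..n}" "card C = r"
    and rho: "1 < rho"
    and rho_le: "\<And>i j. i \<in> C \<Longrightarrow> j \<in> C \<Longrightarrow> i \<noteq> j \<Longrightarrow> rho * th i * th j \<le> 1"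
    and D: "D \<noteq> {}" "D \<subseteq> C"
    and D_max: "edge_mean (p_null th) (in_pairs n C) / (real r * L r)
        \<le> edge_mean (p_null th) (in_pairs n D) / (real (card D) * L (card D))"
    and planted_mean: "A \<le> edge_mean (p_planted th rho C) (in_pairs n D)"
    and eps: "0 < eps"
    and strength: "1 + eps \<le> edge_mean (p_null th) (in_pairs n D) * hfun (rho - 1)
        / (real (card D) * L (card D))"
    and kap: "kap = eps / (6 * (1 + eps))"
    and A_kap: "256 / kap \<le> sqrt A"
    and A_log: "\<And>l. A \<le> l \<Longrightarrow> 4 * ln l + 3 \<le> kap / 4 * (l - 3 * ln l)"
begin

section \<open>Size, weight and signal of the maximizer\<close>

definition k :: real where "k = real (card D)"
definition l :: real where "l = L (card D)"
definition t :: real where "t = sum th D"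
definition mu :: real where "mu = edge_mean (p_null th) (in_pairs n D)"
text \<open>The planted excess over the null mean is \<open>(rho - 1) * mu\<close>, so relative
  errors of order \<open>kap * w\<close> are a small part of it; the cap at 1 keeps them bounded
  when \<open>rho\<close> is large.\<close>

definition w :: real where "w = min 1 (rho - 1)"
definition eta :: real where "eta = kap * w / 128"

lemma finite_C: "finite C"
  using C(1) by (rule finite_subset) simp

lemma D_n: "D \<subseteq> {1..n}"
  using C D by blast

lemma card_D: "1 \<le> card D" "card D \<le> r"
proof -
  have "finite D" using D finite_C finite_subset by blast
  then show "1 \<le> card D" using D by (simp add: Suc_leI card_gt_0_iff)
  show "card D \<le> r" using C D finite_C card_mono by blast
qed

lemma k_ge_1: "1 \<le> k"
  using card_D by (simp add: k_def)

lemma l_ge_A: "A \<le> l"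
  using L_ge_A card_D by (simp add: l_def)

lemma kl_ge_A: "A \<le> k * l"
  using kL_ge_A card_D by (simp add: l_def k_def)

lemma kl_pos: "0 < k * l"
  using kl_ge_A A by linarith

lemma kap_bounds: "0 < kap" "kap \<le> 1 / 6"
  using eps by (auto simp: kap field_simps)

lemma w_bounds: "0 < w" "w \<le> 1" "w \<le> rho - 1"
  using rho by (auto simp: w_def)

lemma eta_bounds: "0 < eta" "eta \<le> 1 / 128"
proof -
  have "kap * w \<le> 1 * 1" using kap_bounds w_bounds by (intro mult_mono) auto
  then show "0 < eta" "eta \<le> 1 / 128" using kap_bounds w_bounds by (auto simp: eta_def)
qed

lemma t_pos: "0 < t"
  unfolding t_def using D_n D by (intro sum_th_pos)

lemma A_t_le_S: "A * t \<le> S"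
  using A_sum_le_S[OF D_n] card_D by (simp add: t_def)

lemma sqrt_A_ge_8: "8 \<le> sqrt A"
  using A by (intro real_le_rsqrt) simp

lemma sqrt_A_sq: "sqrt A * sqrt A = A"
  using A by simp

text \<open>Bounding the weights by \<open>lo\<close> in \<open>C\<close> and by \<open>hi\<close>
  in \<open>D\<close>, and using that the logarithm of \<open>D\<close> is the larger one,
  maximality gives \<open>(r - 1) * lo^2 <= (k - 1) * hi^2\<close>. The first conclusion places
  \<open>D\<close> in the range of the scan; the second controls the diagonal terms.\<close>

lemma card_D_large:
  "real r powr (1/3) \<le> k" "4 * A * hi \<le> k * lo"
proof -
  define x where "x = real r powr (1/3)"
  define R where "R = hi / lo"
  have R: "1 \<le> R" using lo_pos lo_le_hi by (simp add: R_def)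
  have x0: "0 < x" using r by (simp add: x_def)
  have x2: "x\<^sup>2 = real r powr (2/3)" and x3: "x^3 = real r"
    using r_pos by (simp_all add: x_def powr_powr flip: powr_realpow)
  have AR: "A * R\<^sup>2 \<le> x\<^sup>2"
    using ratio_le_r unfolding x2 R_def lo_def hi_def .
  have "64 * R\<^sup>2 \<le> A * R\<^sup>2" using A by (intro mult_right_mono) auto
  then have "(8 * R)\<^sup>2 \<le> A * R\<^sup>2" by (simp add: power_mult_distrib)
  then have xR: "8 * R \<le> x" using AR x0 by (intro power2_le_imp_le[of "8 * R" x]) auto
  then have x8: "8 \<le> x" using R by linarith
  have mono: "edge_mean (p_null (\<lambda>_. lo)) (in_pairs n C) \<le> edge_mean (p_null th) (in_pairs n C)"
    unfolding edge_mean_def p_null_def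
  proof (rule sum_mono, clarify)
    fix i j assume "(i, j) \<in> in_pairs n C"
    then have "i \<in> {1..n}" "j \<in> {1..n}" by (auto simp: in_pairs_def pairs_def)
    then have "lo \<le> th i" "lo \<le> th j" by (auto intro: lo_le)
    then show "lo * lo \<le> th i * th j" using lo_pos by (intro mult_mono) auto
  qed
  have mono': "edge_mean (p_null th) (in_pairs n D) \<le> edge_mean (p_null (\<lambda>_. hi)) (in_pairs n D)"
    unfolding edge_mean_def p_null_def
  proof (rule sum_mono, clarify)
    fix i j assume "(i, j) \<in> in_pairs n D"
    then have ij: "i \<in> {1..n}" "j \<in> {1..n}" by (auto simp: in_pairs_def pairs_def)
    then have "th i \<le> hi" "th j \<le> hi" "0 < th i" "0 < th j"
      using th_range le_hi by blast+
    then show "th i * th j \<le> hi * hi" by (intro mult_mono) auto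
  qed
  have Lr: "A \<le> L r" "L r \<le> l"
    using L_ge_A[of r] r card_D L_antimono[of "card D" r] by (auto simp: l_def)
  have Lr0: "0 < L r" "0 < l" using Lr A by linarith+
  have "(real r - 1) * lo\<^sup>2 / (2 * L r) = (real r * (real r - 1) * lo\<^sup>2 / 2) / (real r * L r)"
    using r_pos Lr0 by (simp add: field_simps)
  also have "\<dots> \<le> edge_mean (p_null th) (in_pairs n C) / (real r * L r)"
    using mono edge_mean_null_const[OF C(1), of lo] C r_pos Lr0
    by (intro divide_right_mono) auto
  also have "\<dots> \<le> edge_mean (p_null th) (in_pairs n D) / (k * l)"
    using D_max by (simp add: k_def l_def)
  also have "\<dots> \<le> (k * (k - 1) * hi\<^sup>2 / 2) / (k * l)"
    using mono' edge_mean_null_const[OF D_n, of hi] kl_pos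
    by (intro divide_right_mono) (auto simp: k_def)
  also have "\<dots> = (k - 1) * hi\<^sup>2 / (2 * l)"
    using k_ge_1 Lr0 by (simp add: field_simps)
  also have "\<dots> \<le> (k - 1) * hi\<^sup>2 / (2 * L r)"
    using k_ge_1 Lr Lr0 by (intro divide_left_mono) auto
  finally have "(real r - 1) * lo\<^sup>2 \<le> (k - 1) * hi\<^sup>2"
    using Lr0 by (simp add: divide_le_cancel)
  then have kR: "x^3 - 1 \<le> (k - 1) * R\<^sup>2"
    using lo_pos by (simp add: x3 R_def power_divide field_simps)
  \<comment> \<open>With \<open>x^3 = r\<close>, the heterogeneity bound
    \<open>A * R^2 <= x^2\<close> leaves one power of \<open>x\<close>, and hence
    \<open>k - 1 >= A * x / 2\<close>.\<close>
  have "A * (x^3 - 1) \<le> (k - 1) * (A * R\<^sup>2)"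
    using mult_left_mono[OF kR, of A] A by (simp add: ac_simps)
  also have "\<dots> \<le> (k - 1) * x\<^sup>2" using AR k_ge_1 by (intro mult_left_mono) auto
  finally have "A * (x^3 - 1) \<le> (k - 1) * x\<^sup>2" .
  moreover have "x^3 / 2 \<le> x^3 - 1"
  proof -
    have "(8::real)^3 \<le> x^3" using x8 by (intro power_mono) auto
    then show ?thesis by simp
  qed
  then have "A * (x^3 / 2) \<le> A * (x^3 - 1)" using A by (intro mult_left_mono) auto
  ultimately have "A * (x^3 / 2) \<le> (k - 1) * x\<^sup>2" by linarith
  also have "A * (x^3 / 2) = (A * x / 2) * x\<^sup>2" by (simp add: power3_eq_cube power2_eq_square)
  finally have "(A * x / 2) * x\<^sup>2 \<le> (k - 1) * x\<^sup>2" .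
  then have k: "A * x / 2 \<le> k - 1" using x0 by (simp add: mult_le_cancel_right)
  have "2 * x \<le> A * x" using A x0 by simp
  then show "real r powr (1/3) \<le> k" using k by (simp add: x_def)
  have "A * (8 * R) \<le> A * x" using xR A by (intro mult_left_mono) auto
  then have "4 * A * R \<le> k" using k by linarith
  then show "4 * A * hi \<le> k * lo" using lo_pos by (simp add: R_def field_simps)
qed

text \<open>The first bound comes from \<open>4 * A * hi <= k * lo\<close>, the second from weights
  below 1. They serve large and small \<open>rho\<close> respectively.\<close>

lemma sum_sq_le: "4 * A * (\<Sum>i\<in>D. (th i)\<^sup>2) \<le> t\<^sup>2" "(\<Sum>i\<in>D. (th i)\<^sup>2) \<le> t"
proof -
  have th: "0 < th i" "th i < 1" "th i \<le> hi" if "i \<in> D" for i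
    using that D_n th_range le_hi by blast+
  have "(\<Sum>i\<in>D. (th i)\<^sup>2) \<le> (\<Sum>i\<in>D. hi * th i)"
    using th by (intro sum_mono) (simp add: power2_eq_square less_imp_le)
  also have "\<dots> = hi * t" by (simp add: t_def sum_distrib_left)
  finally have "4 * A * (\<Sum>i\<in>D. (th i)\<^sup>2) \<le> 4 * A * (hi * t)" using A by (intro mult_left_mono) auto
  also have "\<dots> = (4 * A * hi) * t" by simp
  also have "\<dots> \<le> t * t"
    using card_D_large(2) sum_th_bounds(1)[OF D_n] t_pos
    by (intro mult_right_mono) (auto simp: k_def t_def)
  finally show "4 * A * (\<Sum>i\<in>D. (th i)\<^sup>2) \<le> t\<^sup>2" by (simp add: power2_eq_square)
  show "(\<Sum>i\<in>D. (th i)\<^sup>2) \<le> t"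
    unfolding t_def using th by (intro sum_mono) (simp add: power2_eq_square less_imp_le mult_left_le)
qed

lemma mu_eq: "2 * mu = t\<^sup>2 - (\<Sum>i\<in>D. (th i)\<^sup>2)"
  by (simp add: mu_def t_def edge_mean_null_in[OF D_n])

lemma mu_bounds: "t\<^sup>2 / 4 \<le> mu" "mu \<le> t\<^sup>2 / 2" "0 < mu"
proof -
  have sq: "0 \<le> (\<Sum>i\<in>D. (th i)\<^sup>2)" by (simp add: sum_nonneg)
  then show "mu \<le> t\<^sup>2 / 2" using mu_eq by simp
  have "2 * (\<Sum>i\<in>D. (th i)\<^sup>2) \<le> 4 * A * (\<Sum>i\<in>D. (th i)\<^sup>2)" using A sq by (intro mult_right_mono) auto
  then show "t\<^sup>2 / 4 \<le> mu" using sum_sq_le mu_eq by linarith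
  then show "0 < mu" using t_pos by (smt (verit) divide_pos_pos zero_less_power)
qed

lemma strength_mu: "(1 + eps) * (k * l) \<le> mu * hfun (rho - 1)"
  using strength kl_pos by (simp add: k_def[symmetric] l_def[symmetric] mu_def[symmetric] pos_le_divide_eq)

lemma kl_le_strength: "k * l \<le> mu * hfun (rho - 1)"
  using strength_mu kl_pos eps by (smt (verit) mult_less_cancel_right2)

text \<open>The quadratic bound on \<open>hfun\<close> turns the signal condition into a lower bound
  on \<open>rho - 1\<close>, on the scale \<open>sqrt (k * l) / t\<close> of the required
  precision.\<close>

lemma rho_gap: "2 * (k * l) \<le> (rho - 1)\<^sup>2 * mu" "4 * (k * l) \<le> ((rho - 1) * t)\<^sup>2"
proof -
  have "mu * hfun (rho - 1) \<le> mu * ((rho - 1)\<^sup>2 / 2)"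
    using hfun_le_square[of "rho - 1"] rho mu_bounds by (intro mult_left_mono) auto
  also have "mu * ((rho - 1)\<^sup>2 / 2) = (rho - 1)\<^sup>2 * mu / 2" by simp
  finally show gap: "2 * (k * l) \<le> (rho - 1)\<^sup>2 * mu" using kl_le_strength by linarith
  have "(rho - 1)\<^sup>2 * mu \<le> (rho - 1)\<^sup>2 * (t\<^sup>2 / 2)" using mu_bounds by (intro mult_left_mono) auto
  then show "4 * (k * l) \<le> ((rho - 1) * t)\<^sup>2" using gap by (simp add: power_mult_distrib)
qed

lemma rho_t_ge: "2 * sqrt A \<le> (rho - 1) * t"
proof (rule power2_le_imp_le)
  show "(2 * sqrt A)\<^sup>2 \<le> ((rho - 1) * t)\<^sup>2"
    using rho_gap(2) kl_ge_A A by (simp add: power_mult_distrib)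
qed (use rho t_pos in simp)

text \<open>The two sides differ by diagonal terms. For \<open>rho <= 2\<close> these are at most
  \<open>t\<close>, which is small against \<open>w * t^2\<close> because
  \<open>(rho - 1) * t\<close> is large; for larger \<open>rho\<close> one has \<open>w = 1\<close>,
  and they are at most \<open>t^2 / (4 * A)\<close>.\<close>

lemma bias_le: "t\<^sup>2 / 2 \<le> (1 + kap * w / 8) * mu"
proof -
  have A1: "256 \<le> kap * sqrt A" using A_kap kap_bounds by (simp add: field_simps)
  have "16 * (\<Sum>i\<in>D. (th i)\<^sup>2) \<le> kap * w * t\<^sup>2"
  proof (cases "rho - 1 \<le> 1")
    case True
    have "16 * (\<Sum>i\<in>D. (th i)\<^sup>2) \<le> 256 * t" using sum_sq_le(2) t_pos by linarith
    also have "\<dots> \<le> kap * sqrt A * t" using A1 t_pos by (intro mult_right_mono) auto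
    also have "\<dots> \<le> kap * ((rho - 1) * t) * t"
      using rho_t_ge sqrt_A_ge_8 kap_bounds t_pos by (intro mult_right_mono mult_left_mono) auto
    also have "rho - 1 = w" using True by (simp add: w_def)
    finally show ?thesis by (simp add: power2_eq_square ac_simps)
  next
    case False
    have "1 * sqrt A \<le> sqrt A * sqrt A" using sqrt_A_ge_8 A by (intro mult_right_mono) auto
    then have "sqrt A \<le> A" unfolding sqrt_A_sq by simp
    then have "kap * sqrt A \<le> kap * A" using kap_bounds by (intro mult_left_mono) auto
    then have "16 \<le> kap * (4 * A)" using A1 by linarith
    then have "16 * (\<Sum>i\<in>D. (th i)\<^sup>2) \<le> kap * (4 * A) * (\<Sum>i\<in>D. (th i)\<^sup>2)"
      by (intro mult_right_mono) (auto simp: sum_nonneg)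
    also have "\<dots> = kap * (4 * A * (\<Sum>i\<in>D. (th i)\<^sup>2))" by simp
    also have "\<dots> \<le> kap * t\<^sup>2" using sum_sq_le kap_bounds by (intro mult_left_mono) auto
    finally show ?thesis using False by (simp add: w_def)
  qed
  moreover have "kap * w * (t\<^sup>2 / 4) \<le> kap * w * mu"
    using mu_bounds kap_bounds w_bounds by (intro mult_left_mono) auto
  ultimately show ?thesis using mu_eq by (simp add: distrib_right)
qed

text \<open>The value of \<open>kap\<close> makes \<open>(1 - 3 * kap) * (1 + eps)\<close> equal to
  \<open>1 + eps / 2\<close>, which exceeds the threshold constant.\<close>

lemma final_constant: "(1 + eps / 3) * (k * l) \<le> (1 - kap)^3 * (mu * hfun (rho - 1))"
proof -
  have "(1 + eps / 3) * (k * l) \<le> (1 - 3 * kap) * (1 + eps) * (k * l)"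
  proof (rule mult_right_mono)
    show "1 + eps / 3 \<le> (1 - 3 * kap) * (1 + eps)"
      using eps by (simp add: kap field_simps)
  qed (use kl_pos in simp)
  also have "\<dots> = (1 - 3 * kap) * ((1 + eps) * (k * l))" by simp
  also have "\<dots> \<le> (1 - 3 * kap) * (mu * hfun (rho - 1))"
    using strength_mu kap_bounds by (intro mult_left_mono) auto
  also have "\<dots> \<le> (1 - kap)^3 * (mu * hfun (rho - 1))"
  proof (rule mult_right_mono)
    have "(1 - kap)^3 = 1 - 3 * kap + kap\<^sup>2 * (3 - kap)"
      by (simp add: power3_eq_cube power2_eq_square algebra_simps)
    then show "1 - 3 * kap \<le> (1 - kap)^3" using kap_bounds by simp
    show "0 \<le> mu * hfun (rho - 1)" using kl_le_strength kl_pos by linarith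
  qed
  finally show ?thesis .
qed

text \<open>When the floor dominates, the signal condition forces \<open>rho ln rho\<close> to be at least
  \<open>exp l / l ^ 3\<close>, whereas the floor exceeds \<open>mu\<close> at most by the factor \<open>l ^ 4\<close>.\<close>
lemma floor_case:
  assumes floor: "mu < E_floor (card D)"
    and x: "(1 - kap / 2) * (rho * mu) \<le> x"
  shows "(1 + eps / 3) * (k * l) \<le> phi x (2 * E_floor (card D))"
proof -
  define F where "F = E_floor (card D)"
  define y where "y = (1 - kap / 2) * (rho * mu)"
  have l: "64 \<le> l" using l_ge_A A by linarith
  have F0: "0 < F" using mu_bounds floor by (simp add: F_def)
  have F_eq: "F = k\<^sup>2 / real n * l^4" by (simp add: F_def E_floor_def k_def l_def)
  have F_le: "F \<le> mu * l^4"
  proof -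
    have "4 \<le> real n * lo\<^sup>2" using A_le A by linarith
    then have "k\<^sup>2 * 4 \<le> k\<^sup>2 * (real n * lo\<^sup>2)" by (intro mult_left_mono) auto
    then have "k\<^sup>2 / real n \<le> (k * lo)\<^sup>2 / 4" using n_pos by (simp add: field_simps power_mult_distrib)
    also have "\<dots> \<le> t\<^sup>2 / 4"
      using sum_th_bounds(1)[OF D_n] k_ge_1 lo_pos
      by (intro divide_right_mono power_mono) (auto simp: k_def t_def)
    also have "\<dots> \<le> mu" by (rule mu_bounds)
    finally show ?thesis unfolding F_eq by (intro mult_right_mono) auto
  qed
  have exp_l: "exp l = real n / k"
    using n_pos k_ge_1 by (simp add: l_def L_def k_def)
  have ln_rho: "0 < ln rho" using rho by simp
  have h_le: "hfun (rho - 1) \<le> rho * ln rho" using rho by (simp add: hfun_def)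
  have "k * l \<le> F * (rho * ln rho)"
  proof -
    have "k * l \<le> mu * hfun (rho - 1)" by (rule kl_le_strength)
    also have "\<dots> \<le> F * (rho * ln rho)"
      using floor h_le mu_bounds hfun_nonneg[of "rho - 1"] rho F0
      by (intro mult_mono) (auto simp: F_def)
    finally show ?thesis .
  qed
  then have "k * l * real n \<le> k\<^sup>2 * l^4 * (rho * ln rho)"
    using n_pos by (simp add: F_eq field_simps)
  then have "(k * l) * real n \<le> (k * l) * (k * (l^3 * (rho * ln rho)))"
    by (simp add: power2_eq_square power3_eq_cube power4_eq_xxxx ac_simps)
  then have "real n \<le> k * (l^3 * (rho * ln rho))"
    using kl_pos by (simp only: mult_le_cancel_left_pos)
  then have "exp l \<le> l^3 * (rho * ln rho)"
    using k_ge_1 unfolding exp_l by (simp add: field_simps)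
  \<comment> \<open>The crude bound \<open>ln rho <= rho\<close> suffices, since only logarithms are
    compared afterwards.\<close>
  also have "\<dots> \<le> l^3 * (rho * rho)"
    using rho l ln_le_minus_one[of rho] by (intro mult_left_mono) auto
  finally have "ln (exp l) \<le> ln (l^3 * (rho * rho))" using rho l by (subst ln_le_cancel_iff) auto
  then have "l \<le> 3 * ln l + 2 * ln rho"
    using rho l by (simp add: ln_mult ln_realpow)
  then have "kap / 4 * (l - 3 * ln l) \<le> kap / 4 * (2 * ln rho)"
    using kap_bounds by (intro mult_left_mono) auto
  \<comment> \<open>The term \<open>4 * ln l\<close> pays for the excess of the floor over
    \<open>mu\<close>. The 3 pays for the doubling of the floor, for the factor
    \<open>1 - kap / 2\<close>, and for the summand \<open>- y\<close> in
    \<open>phi y (2 * F)\<close>, one unit each.\<close>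
  then have logs: "4 * ln l + 3 \<le> kap / 2 * ln rho" using A_log[OF l_ge_A] by simp
  have y0: "0 < y" using kap_bounds rho mu_bounds by (simp add: y_def)
  have lnF: "ln F \<le> ln mu + 4 * ln l"
  proof -
    have "ln F \<le> ln (mu * l^4)" using F_le F0 mu_bounds l by (subst ln_le_cancel_iff) auto
    then show ?thesis using mu_bounds l by (simp add: ln_mult ln_realpow)
  qed
  have ln2: "ln 2 \<le> (1::real)" using ln_le_minus_one[of 2] by simp
  have "ln (1 / 2) \<le> ln (1 - kap / 2)" using kap_bounds by (subst ln_le_cancel_iff) auto
  then have lnk: "- 1 \<le> ln (1 - kap / 2)" using ln2 by (simp add: ln_div)
  have "ln (y / (2 * F)) = ln (1 - kap / 2) + ln rho + ln mu - ln 2 - ln F"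
    using y0 F0 kap_bounds rho mu_bounds by (simp add: y_def ln_div ln_mult)
  then have ln_y: "(1 - kap / 2) * ln rho + 1 \<le> ln (y / (2 * F))"
    using lnF ln2 lnk logs by (simp add: left_diff_distrib)
  have y_ge: "2 * F \<le> y"
  proof -
    have "0 \<le> (1 - kap / 2) * ln rho" using kap_bounds ln_rho by simp
    then have "0 \<le> ln (y / (2 * F))" using ln_y by linarith
    then have "1 \<le> y / (2 * F)" using y0 F0 by (subst (asm) ln_ge_zero_iff) auto
    then show ?thesis using F0 by (simp add: field_simps)
  qed
  have hpos: "0 \<le> mu * hfun (rho - 1)" using kl_le_strength kl_pos by linarith
  have "(1 + eps / 3) * (k * l) \<le> (1 - kap)^3 * (mu * hfun (rho - 1))" by (rule final_constant)
  also have "\<dots> \<le> (1 - kap / 2)\<^sup>2 * (mu * hfun (rho - 1))"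
  proof (rule mult_right_mono[OF _ hpos])
    have "(1 - kap)^3 \<le> (1 - kap)\<^sup>2" using kap_bounds by (intro power_decreasing) auto
    also have "\<dots> \<le> (1 - kap / 2)\<^sup>2" using kap_bounds by (intro power_mono) auto
    finally show "(1 - kap)^3 \<le> (1 - kap / 2)\<^sup>2" .
  qed
  also have "\<dots> \<le> (1 - kap / 2)\<^sup>2 * (mu * (rho * ln rho))"
    using h_le mu_bounds by (intro mult_left_mono) auto
  also have "\<dots> = y * ((1 - kap / 2) * ln rho)" by (simp add: y_def power2_eq_square)
  also have "\<dots> \<le> y * (ln (y / (2 * F)) - 1)" using ln_y y0 by (intro mult_left_mono) auto
  also have "\<dots> \<le> phi y (2 * F)" using F0 y_ge by (simp add: phi_above right_diff_distrib)
  also have "\<dots> \<le> phi x (2 * F)" using x F0 by (intro phi_mono) (auto simp: y_def)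
  finally show ?thesis by (simp add: F_def)
qed

text \<open>The deterministic half of the second error bound. \<open>s = kap * w / 2\<close> bounds
  the relative overestimate of \<open>mu\<close> by \<open>E_hat\<close>, combining the diagonal
  bias \<open>s / 4\<close> with the sampling error \<open>s / 8\<close> in the root. The remaining
  cases are whether \<open>mu\<close> or the floor is larger.\<close>

lemma planted_threshold:
  assumes e: "S\<^sup>2 / 2 * (1 - eta) \<le> e_all G" and c: "e_cut G D \<le> (1 + eta) * (t * (S - t))"
    and x: "rho * mu - kap / 2 * ((rho - 1) * mu) \<le> e_in G D"
  shows "1 + eps / 3 \<le> T_u n G D"
proof -
  define s where "s = kap * w / 2"
  have s: "0 < s" "s \<le> kap / 2" "s \<le> 1 / 12"
  proof -
    have "kap * w \<le> kap * 1" using kap_bounds w_bounds by (intro mult_left_mono) auto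
    then show "s \<le> kap / 2" "s \<le> 1 / 12" using kap_bounds unfolding s_def by linarith+
    show "0 < s" using kap_bounds w_bounds by (simp add: s_def)
  qed
  have floor: "0 < E_floor (card D)" using E_floor_pos card_D by simp
  have "6 * t \<le> A * t" using A t_pos by simp
  then have "6 * t \<le> S" using A_t_le_S by linarith
  then have "E_hat G D \<le> t\<^sup>2 / 2 * (1 + 8 * eta)\<^sup>2"
    using E_hat_upper[OF t_pos _ _ _ e c] eta_bounds by simp
  also have "8 * eta = s / 8" by (simp add: eta_def s_def)
  also have "t\<^sup>2 / 2 * (1 + s / 8)\<^sup>2 \<le> ((1 + s / 4) * mu) * (1 + s / 8)\<^sup>2"
    using bias_le by (intro mult_right_mono) (auto simp: s_def)
  also have "\<dots> = mu * ((1 + s / 4) * (1 + s / 8)\<^sup>2)" by simp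
  also have "\<dots> \<le> mu * (1 + s)"
  proof (rule mult_left_mono)
    have "s * s \<le> s" "s * s * s \<le> s" using s by (auto simp: mult_le_one mult_left_le intro!: mult_left_le[of "s * s" s, simplified mult.assoc[symmetric]])
    moreover have "(1 + s / 4) * (1 + s / 8)\<^sup>2 = 1 + s / 2 + 5 / 64 * (s * s) + s * s * s / 256"
      by (simp add: power2_eq_square field_simps)
    ultimately show "(1 + s / 4) * (1 + s / 8)\<^sup>2 \<le> 1 + s" using s by linarith
  qed (use mu_bounds in simp)
  finally have hat: "E_hat G D \<le> (1 + s) * mu" by (simp add: mult.commute)
  have tilde_pos: "0 < E_tilde n G D" using floor by (simp add: E_tilde_eq less_max_iff_disj)
  have "(1 + eps / 3) * (k * l) \<le> phi (e_in G D) (E_tilde n G D)"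
  proof (cases "E_floor (card D) \<le> mu")
    case True
    have "mu \<le> (1 + s) * mu" using s mu_bounds by (simp add: distrib_right)
    then have tilde: "E_tilde n G D \<le> (1 + s) * mu" using hat True by (simp add: E_tilde_eq)
    have "phi (rho * mu) mu = mu * hfun (rho - 1)"
      using mu_bounds rho by (simp add: phi_def)
    then have "(1 + eps / 3) * (k * l) \<le> (1 - kap)^3 * phi (rho * mu) mu"
      using final_constant by simp
    also have "\<dots> \<le> phi (e_in G D) ((1 + s) * mu)"
    proof (rule phi_perturb)
      \<comment> \<open>Half of \<open>kap\<close> covers the overestimate of \<open>mu\<close>, the
        other half the fluctuation of the edge count.\<close>
      have "s \<le> kap / 2 * (rho - 1)" using w_bounds kap_bounds by (simp add: s_def mult_left_mono)
      then have "s * mu \<le> kap / 2 * (rho - 1) * mu" using mu_bounds by (intro mult_right_mono) auto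
      then show "(1 - kap) * (rho * mu - mu) \<le> e_in G D - (1 + s) * mu"
        using x by (simp add: algebra_simps)
      show "(1 + s) * mu \<le> (1 + kap) * mu" using s mu_bounds by (intro mult_right_mono) auto
      show "mu \<le> rho * mu" using rho mu_bounds by simp
    qed (use mu_bounds kap_bounds \<open>mu \<le> (1 + s) * mu\<close> in auto)
    also have "\<dots> \<le> phi (e_in G D) (E_tilde n G D)" using tilde tilde_pos by (intro phi_antimono)
    finally show ?thesis .
  next
    case False
    have "(1 + s) * mu \<le> 2 * mu" using s mu_bounds by (intro mult_right_mono) auto
    then have "(1 + s) * mu \<le> 2 * E_floor (card D)" using False by linarith
    then have tilde: "E_tilde n G D \<le> 2 * E_floor (card D)" using hat floor by (simp add: E_tilde_eq)
    have "kap / 2 * ((rho - 1) * mu) \<le> kap / 2 * (rho * mu)"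
      using kap_bounds mu_bounds by (intro mult_left_mono mult_right_mono) auto
    then have "(1 - kap / 2) * (rho * mu) \<le> e_in G D" using x by (simp add: left_diff_distrib)
    then have "(1 + eps / 3) * (k * l) \<le> phi (e_in G D) (2 * E_floor (card D))"
      using False by (intro floor_case) auto
    also have "\<dots> \<le> phi (e_in G D) (E_tilde n G D)" using tilde tilde_pos by (intro phi_antimono)
    finally show ?thesis .
  qed
  then show ?thesis
    using kl_pos unfolding T_u_eq k_def[symmetric] l_def[symmetric] by (simp only: pos_le_divide_eq)
qed

section \<open>Concentration under the planted law\<close>

lemma r_ge_2: "2 \<le> r"
proof (rule ccontr)
  assume "\<not> 2 \<le> r"
  then have "r = 1" using r by simp
  then have "A * (hi / lo)\<^sup>2 \<le> 1" using ratio_le_r by (simp add: hi_def lo_def)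
  moreover have "A * 1 \<le> A * (hi / lo)\<^sup>2" using A ratio_ge_1 by (intro mult_left_mono) auto
  ultimately show False using A by simp
qed

text \<open>Pairing each vertex of \<open>C\<close> with another one, of weight at least
  \<open>lo\<close>, the constraint on edge probabilities gives \<open>rho * th j <= 1 / lo\<close>.
  This limits the additional cut edges between \<open>D\<close> and \<open>C - D\<close>.\<close>

lemma rho_sum_C: "A * (rho * sum th C) \<le> S"
proof -
  have rho_th: "rho * th j \<le> 1 / lo" if j: "j \<in> C" for j
  proof -
    have "C \<noteq> {j}" using C r_ge_2 by auto
    then obtain i where i: "i \<in> C" "i \<noteq> j" using j by blast
    have "lo \<le> th i" "0 < th j" using i j C lo_le th_range by blast+
    then have "rho * th j * lo \<le> rho * th j * th i" using rho by (intro mult_left_mono) auto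
    also have "\<dots> \<le> 1" using rho_le[of j i] i j by simp
    finally show ?thesis using lo_pos by (simp add: field_simps)
  qed
  have "rho * sum th C = (\<Sum>j\<in>C. rho * th j)" by (simp add: sum_distrib_left)
  also have "\<dots> \<le> real r * (1 / lo)" using sum_bounded_above[of C "\<lambda>j. rho * th j" "1 / lo"] rho_th C(2) by simp
  finally have "A * (rho * sum th C) \<le> A * (real r * (1 / lo))" using A by (intro mult_left_mono) auto
  also have "\<dots> \<le> real n * lo" using A_r_le lo_pos by (simp add: field_simps power2_eq_square)
  also have "\<dots> \<le> S" by (rule S_ge)
  finally show ?thesis .
qed

lemma valid_planted: "valid_prob n (p_planted th rho C)"
proof -
  have "0 \<le> p_planted th rho C i j \<and> p_planted th rho C i j \<le> 1" if ij: "(i, j) \<in> pairs n" for i j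
  proof (cases "i \<in> C \<and> j \<in> C")
    case True
    have "0 < th i" "0 < th j" "i \<noteq> j" using ij th_range by (auto simp: pairs_def)
    then show ?thesis using True rho_le rho by (auto simp: p_planted_def)
  next
    case False
    have "0 \<le> th i * th j" "th i * th j \<le> 1"
      using valid_null ij by (auto simp: valid_prob_def p_null_def)
    then show ?thesis using False by (auto simp: p_planted_def)
  qed
  then show ?thesis by (auto simp: valid_prob_def)
qed

lemma planted_mean_eq: "edge_mean (p_planted th rho C) (in_pairs n D) = rho * mu"
proof -
  have "in_pairs n D \<inter> in_pairs n C = in_pairs n D" using D in_pairs_mono by blast
  then show ?thesis
    unfolding edge_mean_planted[OF in_pairs_subset] by (simp add: mu_def algebra_simps)
qed

lemma type_II_error:
  "prob_ev n (p_planted th rho C) (\<lambda>G. \<not> scan_test n r eps G) \<le> 3 * exp (- kap\<^sup>2 * A / 2^20)"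
proof -
  let ?P = "prob_ev n (p_planted th rho C)"
  \<comment> \<open>In the total and cut events one half of \<open>eta\<close> covers the distance
    of the mean from its idealized value (diagonal terms, planted cut edges), and the other half the
    random fluctuation.\<close>
  define bad_e where "bad_e G \<longleftrightarrow> real (card (G \<inter> pairs n)) \<le> S\<^sup>2 / 2 * (1 - eta / 2) - S\<^sup>2 / 2 * (eta / 2)" for G
  define m where "m = t * (S - t)"
  define bad_cut where "bad_cut G \<longleftrightarrow> m * (1 + eta / 2) + m * (eta / 2) \<le> real (card (G \<inter> cut_pairs n D))" for G
  define bad_in where "bad_in G \<longleftrightarrow> real (card (G \<inter> in_pairs n D)) \<le> rho * mu - kap / 2 * ((rho - 1) * mu)" for G
  have e_eq: "S\<^sup>2 / 2 * (1 - eta / 2) - S\<^sup>2 / 2 * (eta / 2) = S\<^sup>2 / 2 * (1 - eta)"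
    by (simp add: field_simps)
  have cut_eq: "m * (1 + eta / 2) + m * (eta / 2) = (1 + eta) * m"
    by (simp add: field_simps)
  have cover: "bad_e G \<or> bad_cut G \<or> bad_in G" if G: "G \<subseteq> pairs n" and acc: "\<not> scan_test n r eps G" for G
  proof (rule ccontr)
    assume good: "\<not> (bad_e G \<or> bad_cut G \<or> bad_in G)"
    have "S\<^sup>2 / 2 * (1 - eta) \<le> e_all G"
      using good e_all_eq[OF G] unfolding bad_e_def e_eq by simp
    moreover have "e_cut G D \<le> (1 + eta) * (t * (S - t))"
      using good e_cut_eq[OF G, of D] unfolding bad_cut_def cut_eq unfolding m_def by simp
    moreover have "rho * mu - kap / 2 * ((rho - 1) * mu) \<le> e_in G D"
      using good e_in_eq[OF G, of D] by (simp add: bad_in_def)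
    ultimately have T: "1 + eps / 3 \<le> T_u n G D" by (rule planted_threshold)
    define TT where "TT = {T_u n G D | D. D \<subseteq> {1..n} \<and> real r powr (1/3) \<le> real (card D) \<and> card D \<le> r}"
    have "TT \<subseteq> T_u n G ` Pow {1..n}" by (auto simp: TT_def)
    then have finTT: "finite TT" by (rule finite_subset) simp
    have "T_u n G D \<in> TT"
      unfolding TT_def mem_Collect_eq using D_n card_D card_D_large(1) unfolding k_def by blast
    then have "T_u n G D \<le> Max TT" using finTT by (rule Max_ge[rotated])
    then show False using acc T by (simp add: scan_test_def T_stat_def TT_def)
  qed
  have A1: "256 \<le> kap * sqrt A" using A_kap kap_bounds by (simp add: field_simps)
  have A2: "512 \<le> kap * A"
  proof -
    have "256 * 8 \<le> (kap * sqrt A) * sqrt A" using A1 sqrt_A_ge_8 by (intro mult_mono) auto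
    also have "\<dots> = kap * A" using sqrt_A_sq by (simp add: mult.assoc)
    finally show ?thesis by simp
  qed
  have S_A: "sqrt A \<le> S" using A_le_S_square S_pos by (simp add: real_le_lsqrt)
  have "1 * t \<le> A * t" using A t_pos by (intro mult_right_mono) auto
  then have t_S: "t \<le> S" "64 * t \<le> S" using A_t_le_S mult_right_mono[OF A, of t] t_pos by linarith+
  have wS: "sqrt A \<le> w * S"
  proof (cases "rho - 1 \<le> 1")
    case True
    have "(rho - 1) * t \<le> (rho - 1) * S" using t_S rho by (intro mult_left_mono) auto
    then show ?thesis using True rho_t_ge sqrt_A_ge_8 by (simp add: w_def)
  qed (use S_A in \<open>simp add: w_def\<close>)
  have t_lo: "lo \<le> t"
  proof -
    have "1 * lo \<le> k * lo" using k_ge_1 lo_pos by (intro mult_right_mono) auto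
    then show ?thesis using sum_th_bounds(1)[OF D_n] unfolding t_def k_def by linarith
  qed
  \<comment> \<open>The cut has mean of order \<open>t * S\<close>, so this makes a relative
    precision of order \<open>w\<close> attainable. Small \<open>rho\<close> uses
    \<open>rho_gap\<close>; otherwise \<open>t >= lo\<close>, \<open>S >= n * lo\<close> and
    \<open>A_le\<close> suffice.\<close>
  have wtS: "A \<le> w\<^sup>2 * (t * S)"
  proof (cases "rho - 1 \<le> 1")
    case True
    have "A \<le> 4 * (k * l)" using kl_ge_A kl_pos by linarith
    also have "\<dots> \<le> ((rho - 1) * t)\<^sup>2" by (rule rho_gap)
    also have "\<dots> = (rho - 1)\<^sup>2 * (t * t)" by (simp add: power_mult_distrib power2_eq_square)
    also have "\<dots> \<le> (rho - 1)\<^sup>2 * (t * S)" using t_S t_pos by (intro mult_left_mono) auto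
    finally show ?thesis using True by (simp add: w_def)
  next
    case False
    have "A \<le> lo * (real n * lo)" using A_le by (simp add: power2_eq_square ac_simps)
    also have "\<dots> \<le> t * S" using t_lo S_ge lo_pos n_pos t_pos by (intro mult_mono) auto
    finally show ?thesis using False by (simp add: w_def)
  qed
  have m: "t * S / 2 \<le> m"
  proof -
    have "t * (S / 2) \<le> t * (S - t)" using t_S t_pos by (intro mult_left_mono) linarith+
    then show ?thesis by (simp add: m_def)
  qed
  have m0: "0 < m" using m t_pos S_pos by (meson less_le_trans half_gt_zero mult_pos_pos)
  have P_e: "?P bad_e \<le> exp (- kap\<^sup>2 * A / 2^20)"
  proof -
    let ?M = "S\<^sup>2 / 2 * (1 - eta / 2)" and ?a = "S\<^sup>2 / 2 * (eta / 2)"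
    have M0: "0 < ?M" using S_pos eta_bounds by simp
    have "?P bad_e \<le> exp (- ?a\<^sup>2 / (4 * ?M))"
      unfolding bad_e_def
    proof (rule prob_ev_lower_tail[OF valid_planted order_refl _ M0])
      have "(\<Sum>i\<in>{1..n}. (th i)\<^sup>2) \<le> S"
        unfolding S_def using th_range
        by (intro sum_mono) (force simp: power2_eq_square mult_left_le less_imp_le)
      \<comment> \<open>The diagonal of the whole vertex set contributes at most \<open>S\<close>,
        which fits into the first half of \<open>eta\<close>.\<close>
      moreover have "S * 2 \<le> S * (eta * S)"
      proof (rule mult_left_mono)
        have "256 \<le> kap * (w * S)"
          using A1 mult_left_mono[OF wS, of kap] kap_bounds by linarith
        then show "2 \<le> eta * S" by (simp add: eta_def)
      qed (use S_pos in simp)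
      moreover have "edge_mean (p_null th) (pairs n) = (S\<^sup>2 - (\<Sum>i\<in>{1..n}. (th i)\<^sup>2)) / 2"
        using edge_mean_null_in[of "{1..n}" n th] unfolding in_pairs_all S_def by simp
      ultimately have "?M \<le> edge_mean (p_null th) (pairs n)"
        by (simp add: power2_eq_square algebra_simps)
      also have "\<dots> \<le> edge_mean (p_planted th rho C) (pairs n)"
      proof -
        have "0 \<le> edge_mean (p_null th) (pairs n \<inter> in_pairs n C)"
          unfolding edge_mean_def using valid_null by (intro sum_nonneg) (auto simp: valid_prob_def)
        then show ?thesis unfolding edge_mean_planted[OF order_refl] using rho by simp
      qed
      finally show "?M \<le> edge_mean (p_planted th rho C) (pairs n)" .
      have "eta / 2 \<le> 2 * (1 - eta / 2)" using eta_bounds by simp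
      then have "?a \<le> S\<^sup>2 / 2 * (2 * (1 - eta / 2))" by (intro mult_left_mono) auto
      then show "?a \<le> 2 * ?M" by (simp only: mult.left_commute[of 2])
    qed (use eta_bounds in auto)
    also have "- ?a\<^sup>2 / (4 * ?M) \<le> - kap\<^sup>2 * A / 2^20"
    proof -
      have "A \<le> (w * S)\<^sup>2" using power_mono[OF wS, of 2] A by simp
      then have "kap\<^sup>2 * A / 2^20 \<le> kap\<^sup>2 * (w * S)\<^sup>2 / 2^20"
        by (intro divide_right_mono mult_left_mono) auto
      also have "\<dots> \<le> kap\<^sup>2 * (w * S)\<^sup>2 / 2^19" by (intro divide_left_mono) auto
      also have "\<dots> = ?a\<^sup>2 / (4 * (S\<^sup>2 / 2))"
        using S_pos by (simp add: eta_def power2_eq_square)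
      also have "\<dots> \<le> ?a\<^sup>2 / (4 * ?M)"
        using M0 S_pos eta_bounds by (intro divide_left_mono) auto
      finally show ?thesis by simp
    qed
    finally show ?thesis by simp
  qed
  have P_cut: "?P bad_cut \<le> exp (- kap\<^sup>2 * A / 2^20)"
  proof -
    let ?M = "m * (1 + eta / 2)" and ?a = "m * (eta / 2)"
    have M0: "0 < ?M" using m0 eta_bounds by simp
    have "?P bad_cut \<le> exp (- ?a\<^sup>2 / (4 * ?M))"
      unfolding bad_cut_def
    proof (rule prob_ev_upper_tail[OF valid_planted cut_pairs_subset _ M0])
      have "edge_mean (p_planted th rho C) (cut_pairs n D) = m + (rho - 1) * (t * (sum th C - t))"
        unfolding edge_mean_planted[OF cut_pairs_subset] edge_mean_null_cut[OF D_n]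
          edge_mean_null_cut_in[OF D(2) C(1)]
        by (simp add: m_def t_def S_def)
      \<comment> \<open>The mean number of cut edges added by planting. \<open>rho_sum_C\<close>
        covers the cap \<open>w = 1\<close> and \<open>A_sum_le_S\<close> the case
        \<open>w = rho - 1\<close>.\<close>
      also have "(rho - 1) * (t * (sum th C - t)) \<le> t * (w * S / A)"
      proof -
        have sC: "0 \<le> sum th C" using C th_range by (intro sum_nonneg) (blast intro: less_imp_le)
        have "A * ((rho - 1) * sum th C) \<le> A * (rho * sum th C)"
          using A sC by (intro mult_left_mono mult_right_mono) auto
        then have "A * ((rho - 1) * sum th C) \<le> S" using rho_sum_C by linarith
        moreover have "A * ((rho - 1) * sum th C) \<le> (rho - 1) * S"
          using mult_left_mono[OF A_sum_le_S[OF C(1)], of "rho - 1"] C rho by (simp add: ac_simps)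
        ultimately have "A * ((rho - 1) * sum th C) \<le> w * S" by (simp add: w_def min_def)
        then have "(rho - 1) * sum th C \<le> w * S / A" using A by (simp add: field_simps)
        moreover have "(rho - 1) * (sum th C - t) \<le> (rho - 1) * sum th C"
          using rho t_pos by (intro mult_left_mono) auto
        ultimately have "t * ((rho - 1) * (sum th C - t)) \<le> t * (w * S / A)"
          using t_pos by (intro mult_left_mono) auto
        then show ?thesis by (simp add: ac_simps)
      qed
      also have "t * (w * S / A) \<le> m * (eta / 2)"
      proof -
        have "w * S * 512 \<le> w * S * (kap * A)" using A2 w_bounds S_pos by (intro mult_left_mono) auto
        then have "w * S / A \<le> S / 2 * (eta / 2)" using A by (simp add: eta_def field_simps)
        then have "t * (w * S / A) \<le> t * (S / 2 * (eta / 2))" using t_pos by (intro mult_left_mono) auto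
        also have "\<dots> \<le> m * (eta / 2)"
          using mult_right_mono[OF m, of "eta / 2"] eta_bounds by (simp add: ac_simps)
        finally show ?thesis .
      qed
      finally show "edge_mean (p_planted th rho C) (cut_pairs n D) \<le> ?M" by (simp add: distrib_left)
      have "eta / 2 \<le> 2 * (1 + eta / 2)" using eta_bounds by simp
      then have "?a \<le> m * (2 * (1 + eta / 2))" using m0 by (intro mult_left_mono) auto
      then show "?a \<le> 2 * ?M" by (simp only: mult.left_commute[of 2])
    qed (use eta_bounds m0 in auto)
    also have "- ?a\<^sup>2 / (4 * ?M) \<le> - kap\<^sup>2 * A / 2^20"
    proof -
      have "kap\<^sup>2 * A / 2^20 \<le> kap\<^sup>2 * (w\<^sup>2 * (t * S)) / 2^20"
        using wtS by (intro divide_right_mono mult_left_mono) auto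
      also have "\<dots> = (kap * w)\<^sup>2 / 2^19 * (t * S / 2)" by (simp add: power_mult_distrib)
      also have "\<dots> \<le> (kap * w)\<^sup>2 / 2^19 * m" using m by (intro mult_left_mono) auto
      also have "\<dots> = ?a\<^sup>2 / (4 * (m * 2))"
        using m0 by (simp add: eta_def power2_eq_square)
      also have "\<dots> \<le> ?a\<^sup>2 / (4 * ?M)"
        using M0 m0 eta_bounds by (intro divide_left_mono) auto
      finally show ?thesis by simp
    qed
    finally show ?thesis by simp
  qed
  have P_in: "?P bad_in \<le> exp (- kap\<^sup>2 * A / 2^20)"
  proof -
    let ?M = "rho * mu" and ?a = "kap / 2 * ((rho - 1) * mu)"
    have M0: "0 < ?M" using rho mu_bounds by simp
    have "?P bad_in \<le> exp (- ?a\<^sup>2 / (4 * ?M))"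
      unfolding bad_in_def
    proof (rule prob_ev_lower_tail[OF valid_planted in_pairs_subset _ M0])
      have "?a \<le> 1 * (rho * mu)"
        using kap_bounds rho mu_bounds by (intro mult_mono) auto
      then show "?a \<le> 2 * ?M" using M0 by linarith
    qed (use planted_mean_eq kap_bounds rho mu_bounds in auto)
    also have "- ?a\<^sup>2 / (4 * ?M) \<le> - kap\<^sup>2 * A / 2^20"
    proof -
      \<comment> \<open>For \<open>rho <= 2\<close> the signal condition gives this. For larger
        \<open>rho\<close> it is the divergence of the planted mean \<open>rho * mu\<close> that
        enters.\<close>
      have "A * rho \<le> 4 * ((rho - 1)\<^sup>2 * mu)"
      proof (cases "rho \<le> 2")
        case True
        have "A * rho \<le> A * 2" using True A by (intro mult_left_mono) auto
        also have "\<dots> \<le> 4 * ((rho - 1)\<^sup>2 * mu)" using rho_gap(1) kl_ge_A kl_pos by linarith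
        finally show ?thesis .
      next
        case False
        have "A * rho \<le> (rho * mu) * rho"
          using planted_mean planted_mean_eq rho by (intro mult_right_mono) auto
        also have "\<dots> = rho\<^sup>2 * mu" by (simp add: power2_eq_square)
        also have "\<dots> \<le> (2 * (rho - 1))\<^sup>2 * mu"
          using False mu_bounds by (intro mult_right_mono power_mono) auto
        also have "\<dots> = 4 * ((rho - 1)\<^sup>2 * mu)" unfolding power_mult_distrib by simp
        finally show ?thesis .
      qed
      then have "kap\<^sup>2 / 64 * (A * rho) / rho \<le> kap\<^sup>2 / 64 * (4 * ((rho - 1)\<^sup>2 * mu)) / rho"
        using rho by (intro divide_right_mono mult_left_mono) auto
      also have "kap\<^sup>2 / 64 * (A * rho) / rho = kap\<^sup>2 * A / 64" using rho by simp
      also have "kap\<^sup>2 / 64 * (4 * (v\<^sup>2 * mu)) / rho = (kap / 2 * (v * mu))\<^sup>2 / (4 * ?M)" for v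
        using rho mu_bounds by (simp add: power2_eq_square)
      finally have "kap\<^sup>2 * A / 64 \<le> ?a\<^sup>2 / (4 * ?M)" .
      moreover have "kap\<^sup>2 * A / 2^20 \<le> kap\<^sup>2 * A / 64"
        using A by (intro divide_left_mono) auto
      ultimately have "kap\<^sup>2 * A / 2^20 \<le> ?a\<^sup>2 / (4 * ?M)" by linarith
      then show ?thesis by simp
    qed
    finally show ?thesis by simp
  qed
  have "?P (\<lambda>G. \<not> scan_test n r eps G) \<le> ?P (\<lambda>G. bad_e G \<or> (bad_cut G \<or> bad_in G))"
    using cover by (intro prob_ev_mono[OF valid_planted]) auto
  also have "\<dots> \<le> ?P bad_e + ?P (\<lambda>G. bad_cut G \<or> bad_in G)"
    by (rule prob_ev_disj[OF valid_planted])
  also have "?P (\<lambda>G. bad_cut G \<or> bad_in G) \<le> ?P bad_cut + ?P bad_in"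
    by (rule prob_ev_disj[OF valid_planted])
  finally show ?thesis using P_e P_cut P_in by linarith
qed

end

section \<open>The scan test\<close>

lemma rank_one_regimeI:
  fixes th :: "nat \<Rightarrow> real"
  assumes "64 \<le> A" "\<And>i. i \<in> {1..n} \<Longrightarrow> 0 < th i \<and> th i < 1" "1 \<le> r" "r \<le> n"
    and hetero: "A * (Max (th ` {1..n}) / Min (th ` {1..n}))\<^sup>2
      \<le> min (real r powr (2/3)) (real n / real r * (Min (th ` {1..n}))\<^sup>2)"
    and small: "exp A * real r \<le> real n"
  shows "rank_one_regime n r th A"
proof
  have "exp A \<le> real n / real r" using small assms(3) by (simp add: field_simps)
  then show "A \<le> ln (real n / real r)" by (subst ln_ge_iff) (use assms(3,4) in auto)
qed (use assms in auto)

text \<open>All requirements on \<open>A\<close> hold for large \<open>A\<close> simultaneously. The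
  one quantified over \<open>l\<close> follows from \<open>ln l / l\<close> tending to 0.\<close>

lemma eventually_constants:
  fixes eps delta :: real
  assumes eps: "0 < eps" and delta: "0 < delta"
  defines "c \<equiv> eps / (6 * (3 + eps))" and "kap \<equiv> eps / (6 * (1 + eps))"
  shows "\<forall>\<^sub>F A in at_top. 64 \<le> A \<and> 12 \<le> A * eps \<and> 2048 * (1 + eps / 6) / c\<^sup>2 \<le> sqrt A
    \<and> exp (- c\<^sup>2 * A / 2048) + 4 * exp (1 - eps * A / 6) < delta
    \<and> 256 / kap \<le> sqrt A \<and> (\<forall>l\<ge>A. 4 * ln l + 3 \<le> kap / 4 * (l - 3 * ln l))
    \<and> 3 * exp (- kap\<^sup>2 * A / 2^20) < delta"
proof -
  have pos: "0 < c" "0 < kap" using eps by (simp_all add: c_def kap_def)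
  have c2: "0 < c\<^sup>2 / 2048" and k2: "0 < kap\<^sup>2 / 2^20" and e6: "0 < eps / 6"
    using pos eps by simp_all
  have "((\<lambda>A. exp (- c\<^sup>2 * A / 2048) + 4 * exp (1 - eps * A / 6)) \<longlongrightarrow> 0) at_top"
  proof -
    have "((\<lambda>A. exp (- (c\<^sup>2 / 2048 * A)) + 4 * exp 1 * exp (- (eps / 6 * A))) \<longlongrightarrow> 0 + 4 * exp 1 * 0) at_top"
      by (intro tendsto_intros filterlim_compose[OF exp_at_bot] filterlim_uminus_at_bot_at_top
          filterlim_compose[OF filterlim_uminus_at_bot_at_top]
          filterlim_tendsto_pos_mult_at_top[OF tendsto_const] c2 e6 filterlim_ident)
    moreover have "exp (1 - eps * A / 6) = exp 1 * exp (- (eps / 6 * A))" for A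
      by (simp flip: exp_add)
    ultimately show ?thesis by (simp add: mult.assoc)
  qed
  then have ev1: "\<forall>\<^sub>F A in at_top. exp (- c\<^sup>2 * A / 2048) + 4 * exp (1 - eps * A / 6) < delta"
    using delta by (rule order_tendstoD)
  have "((\<lambda>A. 3 * exp (- kap\<^sup>2 * A / 2^20)) \<longlongrightarrow> 0) at_top"
  proof -
    have "((\<lambda>A. 3 * exp (- (kap\<^sup>2 / 2^20 * A))) \<longlongrightarrow> 3 * 0) at_top"
      by (intro tendsto_intros filterlim_compose[OF exp_at_bot]
          filterlim_compose[OF filterlim_uminus_at_bot_at_top]
          filterlim_tendsto_pos_mult_at_top[OF tendsto_const] k2 filterlim_ident)
    then show ?thesis by simp
  qed
  then have ev2: "\<forall>\<^sub>F A in at_top. 3 * exp (- kap\<^sup>2 * A / 2^20) < delta"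
    using delta by (rule order_tendstoD)
  have "((\<lambda>l. ln l / l) \<longlongrightarrow> (0::real)) at_top" by (rule ln_x_over_x_tendsto_0)
  then have "((\<lambda>l. kap / 4 * (1 - 3 * (ln l / l)) - 4 * (ln l / l) - 3 * inverse l)
      \<longlongrightarrow> kap / 4 * (1 - 3 * 0) - 4 * 0 - 3 * 0) at_top"
    by (intro tendsto_intros tendsto_inverse_0_at_top filterlim_ident)
  then have "\<forall>\<^sub>F l in at_top. 0 < kap / 4 * (1 - 3 * (ln l / l)) - 4 * (ln l / l) - 3 * inverse l"
    by (rule order_tendstoD) (use pos in simp)
  then have "\<forall>\<^sub>F l in at_top. 4 * ln l + 3 \<le> kap / 4 * (l - 3 * ln l)"
    using eventually_gt_at_top[of 0]
  proof eventually_elim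
    case (elim l)
    then have "0 \<le> l * (kap / 4 * (1 - 3 * (ln l / l)) - 4 * (ln l / l) - 3 * inverse l)" by simp
    also have "\<dots> = kap / 4 * (l - 3 * ln l) - 4 * ln l - 3" using elim by (simp add: field_simps)
    finally show ?case by simp
  qed
  then have ev3: "\<forall>\<^sub>F A in at_top. \<forall>l\<ge>A. 4 * ln l + 3 \<le> kap / 4 * (l - 3 * ln l)"
    by (rule eventually_all_ge_at_top)
  have ev4: "\<forall>\<^sub>F A in at_top. x \<le> sqrt A" for x
    using sqrt_at_top by (simp add: filterlim_at_top)
  have ev5: "\<forall>\<^sub>F A in at_top. 12 \<le> A * eps"
    using eventually_ge_at_top[of "12 / eps"] by eventually_elim (use eps in \<open>simp add: field_simps\<close>)
  show ?thesis
    using eventually_ge_at_top[of "64::real"] ev5 ev4[of "2048 * (1 + eps / 6) / c\<^sup>2"] ev1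
      ev4[of "256 / kap"] ev3 ev2
    by eventually_elim blast
qed

theorem theorem3:
  fixes theta :: "nat \<Rightarrow> nat \<Rightarrow> real"
    and r :: "nat \<Rightarrow> nat"
    and rho :: "nat \<Rightarrow> nat set \<Rightarrow> real"
    and Dstar :: "nat \<Rightarrow> nat set \<Rightarrow> nat set"
    and eps :: real
  assumes theta_range: "\<And>n i. i \<in> {1..n} \<Longrightarrow> 0 < theta n i \<and> theta n i < 1"
    and r_range: "\<And>n. 1 \<le> n \<Longrightarrow> 1 \<le> r n \<and> r n \<le> n"
    and rho_gt1: "\<And>n C. C \<subseteq> {1..n} \<Longrightarrow> card C = r n \<Longrightarrow> rho n C > 1"
    and rho_le: "\<And>n C i j. C \<subseteq> {1..n} \<Longrightarrow> card C = r n \<Longrightarrow> i \<in> C \<Longrightarrow> j \<in> C \<Longrightarrow> i \<noteq> j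
                   \<Longrightarrow> rho n C * theta n i * theta n j \<le> 1"
    and assumption3: "(\<lambda>n. (Max (theta n ` {1..n}) / Min (theta n ` {1..n}))^2)
                        \<in> o(\<lambda>n. min (real (r n) powr (2/3))
                                     (real n / real (r n) * (Min (theta n ` {1..n}))^2))"
    and eps_pos: "eps > 0"
    and Dstar_max: "\<And>n C. C \<subseteq> {1..n} \<Longrightarrow> card C = r n \<Longrightarrow>
          Dstar n C \<noteq> {} \<and> Dstar n C \<subseteq> C \<and>
          (\<forall>D. D \<noteq> {} \<and> D \<subseteq> C \<longrightarrow>
             expect n (p_null (theta n)) (\<lambda>G. e_in G D) / (real (card D) * ln (real n / real (card D)))
             \<le> expect n (p_null (theta n)) (\<lambda>G. e_in G (Dstar n C))
                / (real (card (Dstar n C)) * ln (real n / real (card (Dstar n C)))))"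
    and r_small: "(\<lambda>n. real (r n)) \<in> o(\<lambda>n. real n)"
    and signal_infty: "\<And>M. \<forall>\<^sub>F n in sequentially. \<forall>C. C \<subseteq> {1..n} \<and> card C = r n \<longrightarrow>
          expect n (p_planted (theta n) (rho n C) C) (\<lambda>G. e_in G (Dstar n C)) \<ge> M"
    and signal_strength: "\<forall>\<^sub>F n in sequentially. \<forall>C. C \<subseteq> {1..n} \<and> card C = r n \<longrightarrow>
          (\<exists>D. D \<noteq> {} \<and> D \<subseteq> C \<and>
             expect n (p_null (theta n)) (\<lambda>G. e_in G D) * hfun (rho n C - 1)
               / (real (card D) * ln (real n / real (card D))) \<ge> 1 + eps)"
  shows "(\<lambda>n. risk n (theta n) (r n) (rho n) (scan_test n (r n) eps)) \<longlonglongrightarrow> 0"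
proof (rule tendstoI)
  fix delta :: real
  assume delta: "0 < delta"
  define c where "c = eps / (6 * (3 + eps))"
  define kap where "kap = eps / (6 * (1 + eps))"
  have "\<exists>A. 64 \<le> A \<and> 12 \<le> A * eps \<and> 2048 * (1 + eps / 6) / c\<^sup>2 \<le> sqrt A
    \<and> exp (- c\<^sup>2 * A / 2048) + 4 * exp (1 - eps * A / 6) < delta / 2
    \<and> 256 / kap \<le> sqrt A \<and> (\<forall>l\<ge>A. 4 * ln l + 3 \<le> kap / 4 * (l - 3 * ln l))
    \<and> 3 * exp (- kap\<^sup>2 * A / 2^20) < delta / 2"
    using eventually_constants[OF eps_pos, of "delta / 2"] delta
    unfolding c_def[symmetric] kap_def[symmetric]
    by (intro eventually_happens'[OF trivial_limit_at_top_linorder]) simp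
  then obtain A where large: "64 \<le> A" "12 \<le> A * eps" "2048 * (1 + eps / 6) / c\<^sup>2 \<le> sqrt A"
    "exp (- c\<^sup>2 * A / 2048) + 4 * exp (1 - eps * A / 6) < delta / 2"
    "256 / kap \<le> sqrt A" "\<And>l. A \<le> l \<Longrightarrow> 4 * ln l + 3 \<le> kap / 4 * (l - 3 * ln l)"
    "3 * exp (- kap\<^sup>2 * A / 2^20) < delta / 2" by blast
  \<comment> \<open>\<open>A\<close> depends only on \<open>eps\<close> and \<open>delta\<close>.
    The two little-o hypotheses are now used with these factors, the exponential one yielding
    \<open>ln (n / r) >= A\<close>.\<close>
  have "0 < 1 / A" "0 < exp (- A)" using large(1) by simp_all
  note small = landau_o.smallD[OF assumption3 this(1)] landau_o.smallD[OF r_small this(2)]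
  from small(1) small(2) signal_infty[of A] signal_strength eventually_ge_at_top[of 1]
  show "\<forall>\<^sub>F n in sequentially. dist (risk n (theta n) (r n) (rho n) (scan_test n (r n) eps)) 0 < delta"
  proof eventually_elim
    case (elim n)
    have r: "1 \<le> r n" "r n \<le> n" using r_range elim by auto
    have hetero: "A * (Max (theta n ` {1..n}) / Min (theta n ` {1..n}))\<^sup>2
      \<le> min (real (r n) powr (2/3)) (real n / real (r n) * (Min (theta n ` {1..n}))\<^sup>2)"
      using elim(1) large(1) r by (simp add: field_simps)
    have "exp A * real (r n) \<le> real n"
      using elim(2) by (simp add: exp_minus field_simps)
    then interpret rank_one_regime n "r n" "theta n" A
      using large(1) theta_range r hetero by (intro rank_one_regimeI)
    have I: "prob_ev n (p_null (theta n)) (scan_test n (r n) eps) < delta / 2"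
      using type_I_error[OF eps_pos c_def large(2,3)] large(4) by linarith
    have II: "prob_ev n (p_planted (theta n) (rho n C) C) (\<lambda>G. \<not> scan_test n (r n) eps G) < delta / 2"
      and II_nonneg: "0 \<le> prob_ev n (p_planted (theta n) (rho n C) C) (\<lambda>G. \<not> scan_test n (r n) eps G)"
      if C: "C \<subseteq> {1..n}" "card C = r n" for C
    proof -
      let ?m = "\<lambda>D. edge_mean (p_null (theta n)) (in_pairs n D)"
      have Ds: "Dstar n C \<noteq> {}" "Dstar n C \<subseteq> C"
        and max_D: "\<And>D. D \<noteq> {} \<Longrightarrow> D \<subseteq> C \<Longrightarrow> ?m D / (real (card D) * L (card D))
          \<le> ?m (Dstar n C) / (real (card (Dstar n C)) * L (card (Dstar n C)))"
        using Dstar_max[OF C] unfolding expect_e_in L_def by simp_all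
      have "C \<noteq> {}" using C r by auto
      from max_D[OF this order_refl] have max_C: "?m C / (real (r n) * L (r n))
          \<le> ?m (Dstar n C) / (real (card (Dstar n C)) * L (card (Dstar n C)))"
        unfolding C(2) .
      have "\<exists>D. D \<noteq> {} \<and> D \<subseteq> C \<and> 1 + eps \<le> ?m D * hfun (rho n C - 1) / (real (card D) * L (card D))"
        using elim(4)[rule_format, OF conjI[OF C]] unfolding expect_e_in L_def .
      then obtain D where D: "D \<noteq> {}" "D \<subseteq> C"
        and st: "1 + eps \<le> ?m D * hfun (rho n C - 1) / (real (card D) * L (card D))"
        by blast
      \<comment> \<open>The factor \<open>hfun (rho n C - 1)\<close> does not depend on
        \<open>D\<close>, so the signal condition passes from some \<open>D\<close> to the
        maximizer.\<close>
      have "?m D / (real (card D) * L (card D)) * hfun (rho n C - 1)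
        \<le> ?m (Dstar n C) / (real (card (Dstar n C)) * L (card (Dstar n C))) * hfun (rho n C - 1)"
        using max_D[OF D] rho_gt1[OF C] by (intro mult_right_mono hfun_nonneg) auto
      then have strength: "1 + eps \<le> ?m (Dstar n C) * hfun (rho n C - 1)
          / (real (card (Dstar n C)) * L (card (Dstar n C)))"
        using st by simp
      have mean: "A \<le> edge_mean (p_planted (theta n) (rho n C) C) (in_pairs n (Dstar n C))"
        using elim(3)[rule_format, OF conjI[OF C]] unfolding expect_e_in .
      interpret planted_regime n "r n" "theta n" A C "Dstar n C" "rho n C" eps kap
        by unfold_locales (fact C Ds max_C strength mean eps_pos large kap_def rho_gt1[OF C] rho_le[OF C])+
      show "prob_ev n (p_planted (theta n) (rho n C) C) (\<lambda>G. \<not> scan_test n (r n) eps G) < delta / 2"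
        using type_II_error large(7) by linarith
      show "0 \<le> prob_ev n (p_planted (theta n) (rho n C) C) (\<lambda>G. \<not> scan_test n (r n) eps G)"
        by (rule prob_ev_nonneg[OF valid_planted])
    qed
    define X where "X = {prob_ev n (p_planted (theta n) (rho n C) C) (\<lambda>G. \<not> scan_test n (r n) eps G)
      | C. C \<subseteq> {1..n} \<and> card C = r n}"
    have "X \<subseteq> (\<lambda>C. prob_ev n (p_planted (theta n) (rho n C) C) (\<lambda>G. \<not> scan_test n (r n) eps G)) ` Pow {1..n}"
      by (auto simp: X_def)
    then have "finite X" by (rule finite_subset) simp
    moreover have "{1..r n} \<subseteq> {1..n}" "card {1..r n} = r n" using r by auto
    then have "X \<noteq> {}" unfolding X_def by blast
    \<comment> \<open>The maximum over communities is attained, so it inherits the bounds proved for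
      each \<open>C\<close>.\<close>
    ultimately have "Max X \<in> X" by (rule Max_in)
    then have "0 \<le> Max X" "Max X < delta / 2" using II II_nonneg unfolding X_def by auto
    moreover have "risk n (theta n) (r n) (rho n) (scan_test n (r n) eps)
        = prob_ev n (p_null (theta n)) (scan_test n (r n) eps) + Max X"
      by (simp add: risk_def X_def)
    ultimately show ?case
      using I prob_ev_nonneg[OF valid_null, of "scan_test n (r n) eps"] by (simp add: dist_real_def)
  qed
qed

end
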